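(* Let $2<\alpha\le 4$ and $\beta>0$. Suppose that there is a constant $C>0$ such that $$p_\mu(x,y,t)\le \frac{C}{t^{\beta}}(1+|x|)^{2-N}(1+|y|)^{2-N}$$ for every $0<t\le 1$ and all $x,y\in\mathbb{R}^N$. Then $$\beta\ge \frac{N+\alpha-4}{\alpha-2}.$$
   Context: Standing assumptions: $N\ge 3$, $\alpha>0$, $m:\mathbb{R}^N\to\mathbb{R}$ is bounded, locally Hölder continuous, with $\inf m>0$, and $L=m(x)(1+|x|^\alpha)\Delta$ on $\mathbb{R}^N$. Let $d\mu(x)=\big(m(x)(1+|x|^\alpha)\big)^{-1}dx$, $L^2_\mu=L^2(\mathbb{R}^N,\mu)$, $H=\{u\in L^2_\mu:\nabla u\in L^2(\mathbb{R}^N,dx)\}$ with inner product $(u,v)_H=\int u\bar v\,d\mu+\int\nabla u\cdot\nabla\bar v\,dx$, and let $\mathcal V$ be the closure of $C_c^1(\mathbb{R}^N)$ in $H$. Let $a(u,v)=\int_{\mathbb{R}^N}\nabla u\cdot\nabla\bar v\,dx$ for $u,v\in\mathcal V$. The operator $L$ is realized in $L^2_\mu$ as the self-adjoint operator with domain $\{u\in\mathcal V:\exists f\in L^2_\mu \text{ with } a(u,v)=-\int f\bar v\,d\mu\ \forall v\in\mathcal V\}$, $Lu=f$. It generates a positive, $L^\infty$-contractive, symmetric semigroup $(T(t))_{t\ge0}$, which has a positive integral kernel $p(x,y,t)$ with respect to Lebesgue measure (taken continuous in $(x,y)$, so that pointwise bounds make sense); set $p_\mu(x,y,t)=m(y)(1+|y|^\alpha)p(x,y,t)$,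 so that $T(t)f(x)=\int_{\mathbb{R}^N}p_\mu(x,y,t)f(y)\,d\mu(y)$. *)

theory Defs
  imports "HOL-Analysis.Analysis"
begin

text \<open>
  Elements of $L^2$ spaces are represented by Borel functions. Identities between them are stated
  almost everywhere, or through the norm, which is only a seminorm on functions.
\<close>

definition L2 :: "'a measure \<Rightarrow> ('a \<Rightarrow> 'b::real_normed_vector) set" where
  "L2 M = {f. f \<in> borel_measurable M \<and> integrable M (\<lambda>x. (norm (f x))\<^sup>2)}"

definition L2_norm :: "'a measure \<Rightarrow> ('a \<Rightarrow> 'b::real_normed_vector) \<Rightarrow> real" where
  "L2_norm M f = sqrt (\<integral>x. (norm (f x))\<^sup>2 \<partial>M)"

definition locally_Holder :: "('a::metric_space \<Rightarrow> real) \<Rightarrow> bool" where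
  "locally_Holder m \<longleftrightarrow>
     (\<forall>K. compact K \<longrightarrow>
        (\<exists>\<gamma> C. 0 < \<gamma> \<and> \<gamma> \<le> 1 \<and> (\<forall>x\<in>K. \<forall>y\<in>K. \<bar>m x - m y\<bar> \<le> C * dist x y powr \<gamma>)))"

definition diff_coeff :: "(real^'n \<Rightarrow> real) \<Rightarrow> real \<Rightarrow> real^'n \<Rightarrow> real" where
  "diff_coeff m \<alpha> x = m x * (1 + norm x powr \<alpha>)"

definition weighted_measure :: "(real^'n \<Rightarrow> real) \<Rightarrow> real \<Rightarrow> (real^'n) measure" where
  "weighted_measure m \<alpha> = density lborel (\<lambda>x. ennreal (inverse (diff_coeff m \<alpha> x)))"


definition partial_deriv :: "'n \<Rightarrow> (real^'n \<Rightarrow> complex) \<Rightarrow> real^'n \<Rightarrow> complex" where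
  "partial_deriv i \<phi> x = frechet_derivative \<phi> (at x) (axis i 1)"

definition Cc1 :: "(real^'n \<Rightarrow> complex) set" where
  "Cc1 = {\<phi>. (\<forall>x. \<phi> differentiable (at x)) \<and> (\<forall>i. continuous_on UNIV (partial_deriv i \<phi>)) \<and>
             compact (closure {x. \<phi> x \<noteq> 0})}"

definition locally_integrable :: "('a::euclidean_space \<Rightarrow> 'b::euclidean_space) \<Rightarrow> bool" where
  "locally_integrable f \<longleftrightarrow> (\<forall>K. compact K \<longrightarrow> set_integrable lborel K f)"

text \<open>
  Distributional gradient. For locally integrable functions, testing with $C_c^1$ functions is
  equivalent to testing with $C_c^\infty$ functions, by mollification.
\<close>

definition has_weak_gradient :: "(real^'n \<Rightarrow> complex) \<Rightarrow> (real^'n \<Rightarrow> complex^'n) \<Rightarrow> bool" where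
  "has_weak_gradient u g \<longleftrightarrow>
     locally_integrable u \<and> locally_integrable g \<and>
     (\<forall>\<phi>\<in>Cc1. \<forall>i. (\<integral>x. u x * partial_deriv i \<phi> x \<partial>lborel) = - (\<integral>x. g x $ i * \<phi> x \<partial>lborel))"

text \<open>A weak gradient is unique up to null sets, so the choice below is harmless.\<close>

definition weak_gradient :: "(real^'n \<Rightarrow> complex) \<Rightarrow> real^'n \<Rightarrow> complex^'n" where
  "weak_gradient u = (SOME g. has_weak_gradient u g)"

text \<open>The inner product of the library on \<open>complex^'n\<close> is the real one, hence the Hermitian one here.\<close>

definition cdot :: "complex^'n \<Rightarrow> complex^'n \<Rightarrow> complex" where
  "cdot z w = (\<Sum>i\<in>UNIV. z $ i * cnj (w $ i))"

definition dirichlet_form :: "(real^'n \<Rightarrow> complex) \<Rightarrow> (real^'n \<Rightarrow> complex) \<Rightarrow> complex" where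
  "dirichlet_form u v = (\<integral>x. cdot (weak_gradient u x) (weak_gradient v x) \<partial>lborel)"

definition H_space :: "(real^'n \<Rightarrow> real) \<Rightarrow> real \<Rightarrow> (real^'n \<Rightarrow> complex) set" where
  "H_space m \<alpha> = {u \<in> L2 (weighted_measure m \<alpha>). \<exists>g\<in>L2 lborel. has_weak_gradient u g}"

definition H_inner ::
  "(real^'n \<Rightarrow> real) \<Rightarrow> real \<Rightarrow> (real^'n \<Rightarrow> complex) \<Rightarrow> (real^'n \<Rightarrow> complex) \<Rightarrow> complex" where
  "H_inner m \<alpha> u v = (\<integral>x. u x * cnj (v x) \<partial>weighted_measure m \<alpha>)
                    + (\<integral>x. cdot (weak_gradient u x) (weak_gradient v x) \<partial>lborel)"

definition H_norm :: "(real^'n \<Rightarrow> real) \<Rightarrow> real \<Rightarrow> (real^'n \<Rightarrow> complex) \<Rightarrow> real" where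
  "H_norm m \<alpha> u = sqrt (Re (H_inner m \<alpha> u u))"

text \<open>The closure of \<open>Cc1\<close> in \<open>H_space m \<alpha>\<close>.\<close>

definition V_space :: "(real^'n \<Rightarrow> real) \<Rightarrow> real \<Rightarrow> (real^'n \<Rightarrow> complex) set" where
  "V_space m \<alpha> =
     {u \<in> H_space m \<alpha>. \<forall>\<epsilon>>0. \<exists>\<phi>\<in>Cc1. H_norm m \<alpha> (\<lambda>x. u x - \<phi> x) < \<epsilon>}"

text \<open>
  The graph of the realization of $L = m(x)(1+|x|^\alpha)\Delta$ in $L^2_\mu$:
  \<open>L_graph m \<alpha> u f\<close> means that \<open>u\<close> is in the domain and $Lu = f$.
\<close>

definition L_graph ::
  "(real^'n \<Rightarrow> real) \<Rightarrow> real \<Rightarrow> (real^'n \<Rightarrow> complex) \<Rightarrow> (real^'n \<Rightarrow> complex) \<Rightarrow> bool" where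
  "L_graph m \<alpha> u f \<longleftrightarrow>
     u \<in> V_space m \<alpha> \<and> f \<in> L2 (weighted_measure m \<alpha>) \<and>
     (\<forall>v\<in>V_space m \<alpha>. dirichlet_form u v = - (\<integral>x. f x * cnj (v x) \<partial>weighted_measure m \<alpha>))"


text \<open>
  Strongly continuous semigroups of bounded linear operators on complex $L^2(M)$. Linearity and
  boundedness imply that each \<open>T t\<close> respects almost everywhere equality.
\<close>

definition C0_semigroup :: "'a measure \<Rightarrow> (real \<Rightarrow> ('a \<Rightarrow> complex) \<Rightarrow> 'a \<Rightarrow> complex) \<Rightarrow> bool" where
  "C0_semigroup M T \<longleftrightarrow>
     (\<forall>t\<ge>0. \<forall>f\<in>L2 M. T t f \<in> L2 M) \<and>
     (\<forall>t\<ge>0. \<forall>f\<in>L2 M. \<forall>g\<in>L2 M. \<forall>a b.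
        AE x in M. T t (\<lambda>y. a * f y + b * g y) x = a * T t f x + b * T t g x) \<and>
     (\<forall>t\<ge>0. \<exists>K. \<forall>f\<in>L2 M. L2_norm M (T t f) \<le> K * L2_norm M f) \<and>
     (\<forall>f\<in>L2 M. AE x in M. T 0 f x = f x) \<and>
     (\<forall>s\<ge>0. \<forall>t\<ge>0. \<forall>f\<in>L2 M. AE x in M. T (s + t) f x = T s (T t f) x) \<and>
     (\<forall>f\<in>L2 M. ((\<lambda>t. L2_norm M (\<lambda>x. T t f x - f x)) \<longlongrightarrow> 0) (at_right 0))"

definition generator_graph ::
  "'a measure \<Rightarrow> (real \<Rightarrow> ('a \<Rightarrow> complex) \<Rightarrow> 'a \<Rightarrow> complex) \<Rightarrow> ('a \<Rightarrow> complex) \<Rightarrow> ('a \<Rightarrow> complex) \<Rightarrow> bool"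
  where
  "generator_graph M T u f \<longleftrightarrow>
     u \<in> L2 M \<and> f \<in> L2 M \<and>
     ((\<lambda>h. L2_norm M (\<lambda>x. (T h u x - u x) / of_real h - f x)) \<longlongrightarrow> 0) (at_right 0)"

definition semigroup_generated_by_L ::
  "(real^'n \<Rightarrow> real) \<Rightarrow> real \<Rightarrow> (real \<Rightarrow> (real^'n \<Rightarrow> complex) \<Rightarrow> real^'n \<Rightarrow> complex) \<Rightarrow> bool" where
  "semigroup_generated_by_L m \<alpha> T \<longleftrightarrow>
     C0_semigroup (weighted_measure m \<alpha>) T \<and>
     (\<forall>u f. generator_graph (weighted_measure m \<alpha>) T u f \<longleftrightarrow> L_graph m \<alpha> u f)"

definition kernel_of ::
  "(real^'n \<Rightarrow> real) \<Rightarrow> real \<Rightarrow> (real \<Rightarrow> (real^'n \<Rightarrow> complex) \<Rightarrow> real^'n \<Rightarrow> complex) \<Rightarrow>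
   (real^'n \<Rightarrow> real^'n \<Rightarrow> real \<Rightarrow> real) \<Rightarrow> bool" where
  "kernel_of m \<alpha> T p \<longleftrightarrow>
     (\<forall>t>0. continuous_on UNIV (\<lambda>(x, y). p x y t) \<and>
        (\<forall>x y. 0 < p x y t) \<and>
        (\<forall>f\<in>L2 (weighted_measure m \<alpha>). AE x in lborel.
           integrable lborel (\<lambda>y. of_real (p x y t) * f y) \<and>
           T t f x = (\<integral>y. of_real (p x y t) * f y \<partial>lborel)))"

definition p_mu ::
  "(real^'n \<Rightarrow> real) \<Rightarrow> real \<Rightarrow> (real^'n \<Rightarrow> real^'n \<Rightarrow> real \<Rightarrow> real) \<Rightarrow>
   real^'n \<Rightarrow> real^'n \<Rightarrow> real \<Rightarrow> real" where
  "p_mu m \<alpha> p x y t = m y * (1 + norm y powr \<alpha>) * p x y t"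

end

theory Submission
  imports Defs
begin

text \<open>
  Write $N$ for the dimension, $\phi(x) = (1+|x|)^{2-N}$, and $\|\cdot\|$, $(\cdot,\cdot)$ for the
  norm and the (real part of the) inner product of $L^2_\mu$. The kernel bound says that
  $(T(t)u,u) \le C t^{-\beta} (\int \phi |u| \, d\mu)^2$ for $t \le 1$. On the other hand $T(t)u$ cannot
  leave $u$ too fast: as $L$ is symmetric and dissipative,
  $(T(t)u,u) \ge \|u\|^2 - t \|u\| \|Lu\|$ for $u$ in the domain of $L$. Together these give the
  weighted Nash type inequality \<open>weighted_Nash_inequality\<close>
  \[ \|u\|^2 \le t \|u\| \|Lu\| + C t^{-\beta} \Big(\int \phi |u| \, d\mu\Big)^2 . \]
  It is tested with a $C^2$ bump of radius $r$ centred at distance $2r$ from the origin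
  (\<open>scaled_test_functions\<close>). On its support the diffusion coefficient is comparable to $r^\alpha$ and
  $\phi$ to $r^{2-N}$, so the inequality reads
  \[ r^{N-\alpha} \le K \big(t r^{N-2} + t^{-\beta} r^{4-2\alpha}\big) . \]
  With $t$ a small multiple of $r^{2-\alpha}$ the first term is absorbed, and $r \to \infty$ forces
  $N + \alpha - 4 \le \beta (\alpha - 2)$ (\<open>scaling_exponent\<close>).

  Two points need work. First, the lower bound for $(T(t)u,u)$ comes from right derivatives of
  $t \mapsto \|T(t)u\|^2$ and $t \mapsto (T(t)u,u)$, so left continuity of orbits is needed as well.
  It follows from a bound on $\|T(t)\|$ that is uniform away from $t = 0$, which the kernel bound
  itself provides since $\phi \in L^2_\mu$ (\<open>semigroup_locally_bounded\<close>). Secondly, the bump lies in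
  the domain of $L$, with $Lu$ given by the classical formula (\<open>L_graph_Cc2\<close>): this rests on
  uniqueness of weak gradients (\<open>weak_gradient_unique\<close>) and on integration by parts
  (\<open>integral_partial_deriv\<close>).
\<close>

section \<open>The inner product of $L^2$\<close>

text \<open>The real part of the Hermitian inner product, which suffices because dissipativity and the
  derivative of a squared norm only see real parts.\<close>

definition L2_inner :: "'a measure \<Rightarrow> ('a \<Rightarrow> complex) \<Rightarrow> ('a \<Rightarrow> complex) \<Rightarrow> real" where
  "L2_inner M f g = (\<integral>x. Re (f x * cnj (g x)) \<partial>M)"

lemma measurable_cnj [measurable]:
  "f \<in> borel_measurable M \<Longrightarrow> (\<lambda>x. cnj (f x)) \<in> borel_measurable M"
  by (rule measurable_compose[OF _ borel_measurable_continuous_onI]) (auto intro: continuous_intros)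

lemma L2_measurable: "f \<in> L2 M \<Longrightarrow> f \<in> borel_measurable M"
  by (simp add: L2_def)

lemma L2_norm_nonneg [simp]: "0 \<le> L2_norm M f"
  by (simp add: L2_norm_def)

lemma L2_norm_sq: "(L2_norm M f)\<^sup>2 = (\<integral>x. (norm (f x))\<^sup>2 \<partial>M)"
  by (simp add: L2_norm_def)

lemma L2_integrable_mult:
  fixes f g :: "'a \<Rightarrow> complex"
  assumes "f \<in> L2 M" "g \<in> L2 M"
  shows "integrable M (\<lambda>x. f x * cnj (g x))"
proof (rule Bochner_Integration.integrable_bound)
  show "integrable M (\<lambda>x. (norm (f x))\<^sup>2 + (norm (g x))\<^sup>2)"
    using assms by (auto simp: L2_def)
  show "(\<lambda>x. f x * cnj (g x)) \<in> borel_measurable M"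
    using assms by (auto simp: L2_def)
  show "AE x in M. norm (f x * cnj (g x)) \<le> norm ((norm (f x))\<^sup>2 + (norm (g x))\<^sup>2)"
  proof (rule AE_I2)
    fix x
    have "0 \<le> (norm (f x) - norm (g x))\<^sup>2 + (norm (f x))\<^sup>2 + (norm (g x))\<^sup>2" by simp
    then show "norm (f x * cnj (g x)) \<le> norm ((norm (f x))\<^sup>2 + (norm (g x))\<^sup>2)"
      by (simp add: power2_eq_square algebra_simps norm_mult)
  qed
qed

lemma L2_integrable_Re_mult:
  assumes "f \<in> L2 M" "g \<in> L2 M"
  shows "integrable M (\<lambda>x. Re (f x * cnj (g x)))"
  using L2_integrable_mult[OF assms] by (rule integrable_Re)

lemma L2_inner_eq_Re_integral:
  assumes "f \<in> L2 M" "g \<in> L2 M"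
  shows "L2_inner M f g = Re (\<integral>x. f x * cnj (g x) \<partial>M)"
  unfolding L2_inner_def using L2_integrable_mult[OF assms] by (rule integral_Re)

lemma L2_scale:
  fixes f :: "'a \<Rightarrow> complex"
  assumes "f \<in> L2 M" shows "(\<lambda>x. a * f x) \<in> L2 M"
  using assms by (auto simp: L2_def norm_mult power_mult_distrib)

lemma L2_add:
  fixes f g :: "'a \<Rightarrow> complex"
  assumes "f \<in> L2 M" "g \<in> L2 M" shows "(\<lambda>x. f x + g x) \<in> L2 M"
proof -
  have "integrable M (\<lambda>x. (norm (f x + g x))\<^sup>2)"
  proof (rule Bochner_Integration.integrable_bound)
    show "integrable M (\<lambda>x. 2 * (norm (f x))\<^sup>2 + 2 * (norm (g x))\<^sup>2)"
      using assms by (auto simp: L2_def)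
    show "(\<lambda>x. (norm (f x + g x))\<^sup>2) \<in> borel_measurable M"
      using assms by (auto simp: L2_def)
    show "AE x in M. norm ((norm (f x + g x))\<^sup>2) \<le> norm (2 * (norm (f x))\<^sup>2 + 2 * (norm (g x))\<^sup>2)"
    proof (rule AE_I2)
      fix x
      have "(norm (f x + g x))\<^sup>2 \<le> (norm (f x) + norm (g x))\<^sup>2"
        by (intro power_mono norm_triangle_ineq) auto
      also have "\<dots> \<le> 2 * (norm (f x))\<^sup>2 + 2 * (norm (g x))\<^sup>2"
        using zero_le_power2[of "norm (f x) - norm (g x)"]
        by (simp add: power2_eq_square algebra_simps)
      finally show "norm ((norm (f x + g x))\<^sup>2) \<le> norm (2 * (norm (f x))\<^sup>2 + 2 * (norm (g x))\<^sup>2)"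
        by simp
    qed
  qed
  then show ?thesis using assms by (auto simp: L2_def)
qed

lemma L2_comb:
  fixes f g :: "'a \<Rightarrow> complex"
  assumes "f \<in> L2 M" "g \<in> L2 M" shows "(\<lambda>x. a * f x + b * g x) \<in> L2 M"
  using L2_add[OF L2_scale[OF assms(1)] L2_scale[OF assms(2)]] .

lemma L2_diff:
  fixes f g :: "'a \<Rightarrow> complex"
  assumes "f \<in> L2 M" "g \<in> L2 M" shows "(\<lambda>x. f x - g x) \<in> L2 M"
  using L2_comb[OF assms, of 1 "-1"] by simp

lemma L2_norm_add_sq:
  assumes "f \<in> L2 M" "g \<in> L2 M"
  shows "(L2_norm M (\<lambda>x. f x + g x))\<^sup>2 = (L2_norm M f)\<^sup>2 + 2 * L2_inner M g f + (L2_norm M g)\<^sup>2"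
proof -
  have pt: "(norm (f x + g x))\<^sup>2 = (norm (f x))\<^sup>2 + 2 * Re (g x * cnj (f x)) + (norm (g x))\<^sup>2" for x
    unfolding cmod_power2 by (simp add: power2_eq_square algebra_simps)
  define r where "r x = Re (g x * cnj (f x))" for x
  have "integrable M r" "integrable M (\<lambda>x. (norm (f x))\<^sup>2)" "integrable M (\<lambda>x. (norm (g x))\<^sup>2)"
    using assms L2_integrable_Re_mult[OF assms(2,1)] by (simp_all add: L2_def r_def[abs_def])
  then show ?thesis
    unfolding L2_norm_sq pt L2_inner_def r_def[symmetric] by simp
qed

lemma L2_inner_add_left:
  assumes "f \<in> L2 M" "g \<in> L2 M" "h \<in> L2 M"
  shows "L2_inner M (\<lambda>x. f x + g x) h = L2_inner M f h + L2_inner M g h"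
  unfolding L2_inner_def
  using L2_integrable_Re_mult[OF assms(1,3)] L2_integrable_Re_mult[OF assms(2,3)]
  by (simp add: distrib_right flip: Bochner_Integration.integral_add)

lemma L2_inner_scale_left: "L2_inner M (\<lambda>x. of_real a * f x) h = a * L2_inner M f h"
proof -
  have "Re (of_real a * f x * cnj (h x)) = a * Re (f x * cnj (h x))" for x by (simp add: algebra_simps)
  then show ?thesis unfolding L2_inner_def by (metis (no_types, lifting) Bochner_Integration.integral_cong integral_mult_right_zero)
qed

lemma L2_norm_scale: "L2_norm M (\<lambda>x. (a::complex) * f x) = norm a * L2_norm M f"
  by (simp add: L2_norm_def norm_mult power_mult_distrib real_sqrt_mult)

lemma L2_norm_cong_AE:
  assumes "f \<in> borel_measurable M" "g \<in> borel_measurable M" "AE x in M. f x = g x"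
  shows "L2_norm M f = L2_norm M g"
  unfolding L2_norm_def using assms by (intro arg_cong[where f=sqrt] integral_cong_AE) auto

lemma L2_inner_cong_AE:
  assumes "f \<in> borel_measurable M" "g \<in> borel_measurable M" "h \<in> borel_measurable M" "AE x in M. f x = g x"
  shows "L2_inner M f h = L2_inner M g h"
  unfolding L2_inner_def using assms by (intro integral_cong_AE) auto

text \<open>The quadratic polynomial $s \mapsto \|g + s f\|^2$ is nonnegative, hence its discriminant is not
  positive.\<close>

lemma L2_inner_le:
  assumes "f \<in> L2 M" "g \<in> L2 M"
  shows "\<bar>L2_inner M f g\<bar> \<le> L2_norm M f * L2_norm M g"
proof -
  let ?a = "L2_norm M f" and ?b = "L2_norm M g" and ?c = "L2_inner M f g"
  have quad: "0 \<le> ?b\<^sup>2 + 2 * s * ?c + s\<^sup>2 * ?a\<^sup>2" for s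
  proof -
    have "0 \<le> (L2_norm M (\<lambda>x. g x + of_real s * f x))\<^sup>2" by simp
    also have "\<dots> = ?b\<^sup>2 + 2 * (s * ?c) + (\<bar>s\<bar> * ?a)\<^sup>2"
      by (subst L2_norm_add_sq[OF assms(2) L2_scale[OF assms(1)]])
        (simp add: L2_inner_scale_left L2_norm_scale)
    finally show ?thesis by (simp add: power_mult_distrib algebra_simps)
  qed
  have "?c\<^sup>2 \<le> (?a * ?b)\<^sup>2"
  proof (cases "?a = 0")
    case True
    have "?c = 0"
    proof (rule ccontr)
      assume "?c \<noteq> 0"
      define s where "s = - (?b\<^sup>2 + 1) / (2 * ?c)"
      have "2 * s * ?c = - (?b\<^sup>2 + 1)"
        using \<open>?c \<noteq> 0\<close> by (simp add: s_def)
      then show False using quad[of s] True by simp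
    qed
    then show ?thesis by simp
  next
    case False
    then have "0 \<le> ?a\<^sup>2 * (?b\<^sup>2 + 2 * (- ?c / ?a\<^sup>2) * ?c + (- ?c / ?a\<^sup>2)\<^sup>2 * ?a\<^sup>2)"
      by (intro mult_nonneg_nonneg quad) auto
    also have "\<dots> = (?a * ?b)\<^sup>2 - ?c\<^sup>2"
      using False by (simp add: field_simps power2_eq_square)
    finally show ?thesis by simp
  qed
  then have "\<bar>?c\<bar> \<le> \<bar>?a * ?b\<bar>" by (simp only: abs_le_square_iff)
  then show ?thesis by simp
qed

lemma L2_norm_triangle:
  fixes f g :: "'a \<Rightarrow> complex"
  assumes "f \<in> L2 M" "g \<in> L2 M"
  shows "L2_norm M (\<lambda>x. f x + g x) \<le> L2_norm M f + L2_norm M g"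
proof (rule power2_le_imp_le)
  show "(L2_norm M (\<lambda>x. f x + g x))\<^sup>2 \<le> (L2_norm M f + L2_norm M g)\<^sup>2"
    using L2_norm_add_sq[OF assms] L2_inner_le[OF assms(2,1)]
    by (simp add: power2_eq_square algebra_simps)
qed simp

section \<open>Orbits of a semigroup with a dissipative generator\<close>

text \<open>Orbits are a priori differentiable from the right only, which is why a one-sided version of the
  mean value inequality is used. For fixed \<open>e > 0\<close>, the last point at which
  \<open>f t \<le> f a + e (t - a)\<close> holds is \<open>b\<close>.\<close>

lemma right_Dini_nonincreasing:
  fixes f :: "real \<Rightarrow> real"
  assumes "a \<le> b" and cont: "continuous_on {a..b} f"
    and dini: "\<And>t e. \<lbrakk>a \<le> t; t < b; 0 < e\<rbrakk> \<Longrightarrow> \<forall>\<^sub>F h in at_right 0. f (t + h) \<le> f t + e * h"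
  shows "f b \<le> f a"
proof (rule field_le_epsilon)
  fix e' :: real assume "0 < e'"
  define e where "e = e' / (b - a + 1)"
  have e: "0 < e" using \<open>0 < e'\<close> \<open>a \<le> b\<close> by (simp add: e_def)
  define S where "S = {t \<in> {a..b}. f t - e * (t - a) \<le> f a}"
  have "closed S"
    unfolding S_def by (intro continuous_on_closed_Collect_le continuous_intros cont)
  have ne: "a \<in> S" using \<open>a \<le> b\<close> by (simp add: S_def)
  have bdd: "bdd_above S" by (auto simp: S_def intro: bdd_aboveI[of _ b])
  define s where "s = Sup S"
  have "s \<in> S" unfolding s_def using ne bdd \<open>closed S\<close> by (auto intro: closed_contains_Sup)
  have "s = b"
  proof (rule ccontr)
    assume "s \<noteq> b"
    with \<open>s \<in> S\<close> have s: "a \<le> s" "s < b" by (auto simp: S_def)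
    have "\<forall>\<^sub>F h in at_right 0. h \<in> {0<..<b - s}"
      using s by (intro eventually_at_right_real) auto
    then have "\<forall>\<^sub>F h in at_right 0. f (s + h) \<le> f s + e * h \<and> h \<in> {0<..<b - s}"
      using dini[OF s e] by eventually_elim auto
    then obtain h where h: "f (s + h) \<le> f s + e * h" "h \<in> {0<..<b - s}"
      using eventually_happens'[OF trivial_limit_at_right_real] by blast
    then have "s + h \<in> S" using \<open>s \<in> S\<close> by (auto simp: S_def algebra_simps)
    then have "s + h \<le> s" unfolding s_def using bdd by (rule cSup_upper)
    with h show False by auto
  qed
  with \<open>s \<in> S\<close> have "f b \<le> f a + e * (b - a)" by (simp add: S_def)
  also have "e * (b - a) \<le> e'"
    using \<open>0 < e'\<close> \<open>a \<le> b\<close> by (simp add: e_def field_simps)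
  finally show "f b \<le> f a + e'" by simp
qed

context
  fixes M :: "'a measure" and T :: "real \<Rightarrow> ('a \<Rightarrow> complex) \<Rightarrow> 'a \<Rightarrow> complex"
  assumes sg: "C0_semigroup M T"
begin

lemma semigroup_L2: "0 \<le> t \<Longrightarrow> f \<in> L2 M \<Longrightarrow> T t f \<in> L2 M"
  using sg by (simp add: C0_semigroup_def)

lemma semigroup_lin:
  "\<lbrakk>0 \<le> t; f \<in> L2 M; g \<in> L2 M\<rbrakk> \<Longrightarrow>
    AE x in M. T t (\<lambda>y. a * f y + b * g y) x = a * T t f x + b * T t g x"
  using sg by (simp add: C0_semigroup_def)

lemma semigroup_diff:
  assumes "0 \<le> t" "f \<in> L2 M" "g \<in> L2 M"
  shows "AE x in M. T t (\<lambda>y. f y - g y) x = T t f x - T t g x"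
  using semigroup_lin[OF assms, of 1 "-1"] by simp

lemma semigroup_add:
  "\<lbrakk>0 \<le> s; 0 \<le> t; f \<in> L2 M\<rbrakk> \<Longrightarrow> AE x in M. T (s + t) f x = T s (T t f) x"
  using sg by (simp add: C0_semigroup_def)

lemma semigroup_zero: "f \<in> L2 M \<Longrightarrow> AE x in M. T 0 f x = f x"
  using sg by (simp add: C0_semigroup_def)

lemma semigroup_bounded:
  assumes "0 \<le> t"
  obtains K where "0 \<le> K" "\<And>f. f \<in> L2 M \<Longrightarrow> L2_norm M (T t f) \<le> K * L2_norm M f"
proof -
  from sg assms obtain K where K: "\<forall>f\<in>L2 M. L2_norm M (T t f) \<le> K * L2_norm M f"
    unfolding C0_semigroup_def by blast
  have "L2_norm M (T t f) \<le> max K 0 * L2_norm M f" if "f \<in> L2 M" for f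
    using K that mult_right_mono[of K "max K 0" "L2_norm M f"] by fastforce
  then show ?thesis by (intro that[of "max K 0"]) auto
qed

lemma semigroup_tendsto:
  "f \<in> L2 M \<Longrightarrow> ((\<lambda>t. L2_norm M (\<lambda>x. T t f x - f x)) \<longlongrightarrow> 0) (at_right 0)"
  using sg by (simp add: C0_semigroup_def)

lemma semigroup_shift_diff:
  assumes "0 \<le> s" "0 \<le> t" "0 \<le> h" "f \<in> L2 M"
  shows "L2_norm M (\<lambda>x. T (s + t + h) f x - T (s + t) f x)
       = L2_norm M (T s (\<lambda>x. T (t + h) f x - T t f x))"
proof (rule L2_norm_cong_AE)
  have "AE x in M. T (s + (t + h)) f x = T s (T (t + h) f) x"
    using assms by (intro semigroup_add) auto
  moreover have "AE x in M. T (s + t) f x = T s (T t f) x"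
    using assms by (intro semigroup_add) auto
  moreover have "AE x in M. T s (\<lambda>x. T (t + h) f x - T t f x) x = T s (T (t + h) f) x - T s (T t f) x"
    using assms by (intro semigroup_diff semigroup_L2) auto
  ultimately show "AE x in M. T (s + t + h) f x - T (s + t) f x = T s (\<lambda>x. T (t + h) f x - T t f x) x"
    by eventually_elim (simp add: add.assoc)
qed (use assms in \<open>auto intro!: L2_measurable semigroup_L2 L2_diff\<close>)

lemma semigroup_right_continuous:
  assumes "0 \<le> t" "f \<in> L2 M" "0 < e"
  obtains d where "0 < d" "\<And>h. \<lbrakk>0 < h; h < d\<rbrakk> \<Longrightarrow> L2_norm M (\<lambda>x. T (t + h) f x - T t f x) < e"
proof -
  from assms(1) obtain K where K: "0 \<le> K" "\<And>f. f \<in> L2 M \<Longrightarrow> L2_norm M (T t f) \<le> K * L2_norm M f"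
    using semigroup_bounded by blast
  have "((\<lambda>h. K * L2_norm M (\<lambda>x. T h f x - f x)) \<longlongrightarrow> K * 0) (at_right 0)"
    by (intro tendsto_intros semigroup_tendsto assms)
  then have "\<forall>\<^sub>F h in at_right 0. K * L2_norm M (\<lambda>x. T h f x - f x) < e"
    using \<open>0 < e\<close> by (intro order_tendstoD(2)[of _ "K * 0"]) auto
  then obtain d where d: "0 < d" "\<And>h. \<lbrakk>0 < h; h < d\<rbrakk> \<Longrightarrow> K * L2_norm M (\<lambda>x. T h f x - f x) < e"
    unfolding eventually_at_right_field by auto
  have "L2_norm M (\<lambda>x. T (t + h) f x - T t f x) < e" if "0 < h" "h < d" for h
  proof -
    have T0: "T 0 f \<in> L2 M" "T h f \<in> L2 M" using assms that by (auto intro: semigroup_L2)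
    have "L2_norm M (\<lambda>x. T (t + h) f x - T t f x) = L2_norm M (T t (\<lambda>x. T h f x - T 0 f x))"
      using semigroup_shift_diff[of t 0 h f] assms that by simp
    also have "\<dots> \<le> K * L2_norm M (\<lambda>x. T h f x - T 0 f x)"
      using T0 by (intro K L2_diff)
    also have "L2_norm M (\<lambda>x. T h f x - T 0 f x) = L2_norm M (\<lambda>x. T h f x - f x)"
      using semigroup_zero[OF assms(2)] T0 assms
      by (intro L2_norm_cong_AE) (auto intro!: L2_measurable L2_diff)
    also have "K * \<dots> < e" using d that by blast
    finally show ?thesis .
  qed
  with \<open>0 < d\<close> show ?thesis by (rule that)
qed

text \<open>The bounded operator \<open>T t\<close> commutes with \<open>T h\<close>, hence with the difference quotients that define
  the generator.\<close>

lemma generator_shift: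
  assumes gen: "generator_graph M T u f" and "0 \<le> t"
  shows "generator_graph M T (T t u) (T t f)"
proof -
  have uf: "u \<in> L2 M" "f \<in> L2 M" using gen by (auto simp: generator_graph_def)
  let ?q = "\<lambda>h x. (T h u x - u x) / of_real h - f x"
  from \<open>0 \<le> t\<close> obtain K where K: "0 \<le> K" "\<And>f. f \<in> L2 M \<Longrightarrow> L2_norm M (T t f) \<le> K * L2_norm M f"
    using semigroup_bounded by blast
  have le: "L2_norm M (\<lambda>x. (T h (T t u) x - T t u x) / of_real h - T t f x) \<le> K * L2_norm M (?q h)"
    if "0 < h" for h :: real
  proof -
    have L: "T h u \<in> L2 M" "T t u \<in> L2 M" "T h (T t u) \<in> L2 M" "T t f \<in> L2 M"
      using uf that \<open>0 \<le> t\<close> by (auto intro!: semigroup_L2)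
    let ?e = "\<lambda>x. (1 / of_real h) * T h u x + (- 1 / of_real h) * u x"
    have e: "?e \<in> L2 M" by (intro L2_comb L uf)
    have q: "?q h = (\<lambda>x. ?e x - f x)" by (simp add: diff_divide_distrib)
    have qL: "?q h \<in> L2 M" unfolding q by (intro L2_diff e uf)
    have "AE x in M. T t (?q h) x = T t ?e x - T t f x"
      unfolding q by (intro semigroup_diff e uf assms)
    moreover have "AE x in M. T t ?e x = (1 / of_real h) * T t (T h u) x + (- 1 / of_real h) * T t u x"
      by (intro semigroup_lin L uf assms)
    moreover have "AE x in M. T (t + h) u x = T t (T h u) x"
      using that by (intro semigroup_add uf assms) auto
    moreover have "AE x in M. T (h + t) u x = T h (T t u) x"
      using that by (intro semigroup_add uf assms) auto
    ultimately have "AE x in M. (T h (T t u) x - T t u x) / of_real h - T t f x = T t (?q h) x"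
      by eventually_elim (simp add: add.commute diff_divide_distrib)
    moreover have "(\<lambda>x. (T h (T t u) x - T t u x) / of_real h - T t f x) \<in> borel_measurable M"
      using L[THEN L2_measurable] by measurable
    moreover have "T t (?q h) \<in> borel_measurable M"
      by (intro L2_measurable semigroup_L2 qL assms)
    ultimately have "L2_norm M (\<lambda>x. (T h (T t u) x - T t u x) / of_real h - T t f x) = L2_norm M (T t (?q h))"
      by (intro L2_norm_cong_AE)
    then show ?thesis using K(2)[OF qL] by simp
  qed
  have "((\<lambda>h. K * L2_norm M (?q h)) \<longlongrightarrow> K * 0) (at_right 0)"
    using gen by (intro tendsto_intros) (simp add: generator_graph_def)
  then have lim: "((\<lambda>h. K * L2_norm M (?q h)) \<longlongrightarrow> 0) (at_right 0)" by simp
  have "((\<lambda>h. L2_norm M (\<lambda>x. (T h (T t u) x - T t u x) / of_real h - T t f x)) \<longlongrightarrow> 0) (at_right 0)"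
    by (rule tendsto_sandwich[OF _ _ tendsto_const lim])
      (auto intro!: eventually_at_rightI[of 0 1] le)
  then show ?thesis
    using uf assms by (simp add: generator_graph_def semigroup_L2)
qed

lemma generator_expansion:
  assumes gen: "generator_graph M T u f" and "0 \<le> t"
  obtains r where "((\<lambda>h. L2_norm M (r h)) \<longlongrightarrow> 0) (at_right 0)"
    "\<And>h. 0 < h \<Longrightarrow> r h \<in> L2 M"
    "\<And>h. 0 < h \<Longrightarrow> AE x in M. T (t + h) u x = T t u x + of_real h * (T t f x + r h x)"
proof -
  have uf: "u \<in> L2 M" "f \<in> L2 M" using gen by (auto simp: generator_graph_def)
  define r where "r h x = (T h (T t u) x - T t u x) / of_real h - T t f x" for h :: real and x
  show thesis
  proof (rule that[of r])
    show "((\<lambda>h. L2_norm M (r h)) \<longlongrightarrow> 0) (at_right 0)"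
      using generator_shift[OF assms] by (simp add: generator_graph_def r_def[abs_def])
    fix h :: real assume "0 < h"
    then have L: "T t u \<in> L2 M" "T h (T t u) \<in> L2 M" "T t f \<in> L2 M"
      using uf \<open>0 \<le> t\<close> by (auto intro!: semigroup_L2)
    have "r h = (\<lambda>x. ((1 / of_real h) * T h (T t u) x + (- 1 / of_real h) * T t u x) - T t f x)"
      by (auto simp: r_def diff_divide_distrib)
    also have "\<dots> \<in> L2 M" by (intro L2_diff L2_comb L)
    finally show "r h \<in> L2 M" .
    have "AE x in M. T (h + t) u x = T h (T t u) x"
      using \<open>0 < h\<close> assms by (intro semigroup_add uf) auto
    then show "AE x in M. T (t + h) u x = T t u x + of_real h * (T t f x + r h x)"
      by eventually_elim (use \<open>0 < h\<close> in \<open>simp add: r_def add.commute\<close>)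
  qed
qed

context
  assumes locally_bounded:
    "\<And>\<delta>. 0 < \<delta> \<Longrightarrow> \<exists>K. \<forall>t f. \<delta> \<le> t \<and> t \<le> 1 \<and> f \<in> L2 M \<longrightarrow> L2_norm M (T t f) \<le> K * L2_norm M f"
begin

text \<open>For \<open>h\<close> small, \<open>T t f - T (t - h) f\<close> is the image under \<open>T (t - h - t/3)\<close> of
  \<open>T (t/3 + h) f - T (t/3) f\<close>. The first factor is bounded uniformly in \<open>h\<close>, and the second is small by
  right continuity at \<open>t/3\<close>. Local boundedness is assumed away from zero only, which is what the
  kernel bound gives.\<close>

lemma semigroup_left_continuous:
  assumes "0 < t" "t \<le> 1" "f \<in> L2 M" "0 < e"
  obtains d where "0 < d" "\<And>h. \<lbrakk>0 < h; h < d; h \<le> t\<rbrakk> \<Longrightarrow> L2_norm M (\<lambda>x. T t f x - T (t - h) f x) < e"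
proof -
  from locally_bounded[of "t / 3"] \<open>0 < t\<close> obtain K0 where
    K0: "\<And>s f. \<lbrakk>t / 3 \<le> s; s \<le> 1; f \<in> L2 M\<rbrakk> \<Longrightarrow> L2_norm M (T s f) \<le> K0 * L2_norm M f"
    by auto
  define K where "K = max K0 1"
  have K: "L2_norm M (T s f) \<le> K * L2_norm M f" if "t / 3 \<le> s" "s \<le> 1" "f \<in> L2 M" for s f
    using K0[OF that] mult_right_mono[of K0 K "L2_norm M f"] by (simp add: K_def)
  have "0 < K" by (simp add: K_def)
  have t3: "0 \<le> t / 3" "0 < e / K" using assms \<open>0 < K\<close> by auto
  from semigroup_right_continuous[OF t3(1) \<open>f \<in> L2 M\<close> t3(2)] obtain d where
    d: "0 < d" "\<And>h. \<lbrakk>0 < h; h < d\<rbrakk> \<Longrightarrow> L2_norm M (\<lambda>x. T (t / 3 + h) f x - T (t / 3) f x) < e / K"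
    by blast
  show thesis
  proof (rule that[of "min d (t / 3)"])
    show "0 < min d (t / 3)" using d assms by auto
    fix h assume h: "0 < h" "h < min d (t / 3)" "h \<le> t"
    define s where "s = t - h - t / 3"
    have s: "t / 3 \<le> s" "s \<le> 1" "0 \<le> s" using h assms by (auto simp: s_def)
    have "L2_norm M (\<lambda>x. T t f x - T (t - h) f x) = L2_norm M (\<lambda>x. T (s + t / 3 + h) f x - T (s + t / 3) f x)"
      by (simp add: s_def)
    also have "\<dots> = L2_norm M (T s (\<lambda>x. T (t / 3 + h) f x - T (t / 3) f x))"
      using s h assms by (intro semigroup_shift_diff) auto
    also have "\<dots> \<le> K * L2_norm M (\<lambda>x. T (t / 3 + h) f x - T (t / 3) f x)"
      using s h assms by (intro K L2_diff semigroup_L2) auto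
    also have "\<dots> < K * (e / K)"
      using h d \<open>0 < K\<close> by (intro mult_strict_left_mono) auto
    finally show "L2_norm M (\<lambda>x. T t f x - T (t - h) f x) < e" using \<open>0 < K\<close> by simp
  qed
qed

lemma semigroup_continuous:
  assumes "0 \<le> t" "t \<le> 1" "f \<in> L2 M" "0 < e"
  obtains d where "0 < d"
    "\<And>s. \<lbrakk>0 \<le> s; s \<le> 1; \<bar>s - t\<bar> < d\<rbrakk> \<Longrightarrow> L2_norm M (\<lambda>x. T s f x - T t f x) < e"
proof -
  obtain d1 where d1: "0 < d1"
    "\<And>h. \<lbrakk>0 < h; h < d1\<rbrakk> \<Longrightarrow> L2_norm M (\<lambda>x. T (t + h) f x - T t f x) < e"
    using semigroup_right_continuous[OF assms(1,3,4)] by blast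
  obtain d2 where d2: "0 < d2"
    "\<And>h. \<lbrakk>0 < h; h < d2; h \<le> t\<rbrakk> \<Longrightarrow> L2_norm M (\<lambda>x. T t f x - T (t - h) f x) < e"
  proof (cases "t = 0")
    case True
    then show ?thesis by (intro that[of 1]) auto
  next
    case False
    with assms have "0 < t" by simp
    then show ?thesis using semigroup_left_continuous[OF _ assms(2-4)] that by metis
  qed
  show ?thesis
  proof (rule that[of "min d1 d2"])
    show "0 < min d1 d2" using d1 d2 by simp
    fix s assume s: "0 \<le> s" "s \<le> 1" "\<bar>s - t\<bar> < min d1 d2"
    consider "s = t" | "t < s" | "s < t" by linarith
    then show "L2_norm M (\<lambda>x. T s f x - T t f x) < e"
    proof cases
      case 1
      then show ?thesis using \<open>0 < e\<close> by (simp add: L2_norm_def)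
    next
      case 2
      then show ?thesis using d1(2)[of "s - t"] s by auto
    next
      case 3
      have "L2_norm M (\<lambda>x. T s f x - T t f x) = L2_norm M (\<lambda>x. T t f x - T s f x)"
        by (simp add: L2_norm_def norm_minus_commute)
      also have "\<dots> < e" using d2(2)[of "t - s"] s 3 by auto
      finally show ?thesis .
    qed
  qed
qed

lemma continuous_on_L2_norm_orbit:
  assumes "f \<in> L2 M"
  shows "continuous_on {0..1} (\<lambda>t. L2_norm M (T t f))"
  unfolding continuous_on_iff
proof (intro ballI allI impI)
  fix t e :: real assume te: "t \<in> {0..1}" "0 < e"
  then obtain d where d: "0 < d"
    "\<And>s. \<lbrakk>0 \<le> s; s \<le> 1; \<bar>s - t\<bar> < d\<rbrakk> \<Longrightarrow> L2_norm M (\<lambda>x. T s f x - T t f x) < e"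
    using semigroup_continuous[of t f e] assms by auto
  have "\<bar>L2_norm M (T s f) - L2_norm M (T t f)\<bar> < e" if "s \<in> {0..1}" "\<bar>s - t\<bar> < d" for s
  proof -
    have L: "T s f \<in> L2 M" "T t f \<in> L2 M" using te that assms by (auto intro: semigroup_L2)
    have "L2_norm M (T s f) \<le> L2_norm M (\<lambda>x. T s f x - T t f x) + L2_norm M (T t f)"
      using L2_norm_triangle[OF L2_diff[OF L] L(2)] by simp
    moreover have "L2_norm M (T t f) \<le> L2_norm M (\<lambda>x. T t f x - T s f x) + L2_norm M (T s f)"
      using L2_norm_triangle[OF L2_diff[OF L(2,1)] L(1)] by simp
    moreover have "L2_norm M (\<lambda>x. T t f x - T s f x) = L2_norm M (\<lambda>x. T s f x - T t f x)"
      by (simp add: L2_norm_def norm_minus_commute)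
    moreover have "L2_norm M (\<lambda>x. T s f x - T t f x) < e" using d that by auto
    ultimately show ?thesis by linarith
  qed
  then show "\<exists>d>0. \<forall>s\<in>{0..1}. dist s t < d \<longrightarrow> dist (L2_norm M (T s f)) (L2_norm M (T t f)) < e"
    using d(1) by (auto simp: dist_real_def)
qed

lemma continuous_on_L2_inner_orbit:
  assumes "f \<in> L2 M" "g \<in> L2 M"
  shows "continuous_on {0..1} (\<lambda>t. L2_inner M (T t f) g)"
  unfolding continuous_on_iff
proof (intro ballI allI impI)
  fix t e :: real assume te: "t \<in> {0..1}" "0 < e"
  have e': "0 < e / (L2_norm M g + 1)" using te by (simp add: add_nonneg_pos)
  with te obtain d where d: "0 < d"
    "\<And>s. \<lbrakk>0 \<le> s; s \<le> 1; \<bar>s - t\<bar> < d\<rbrakk> \<Longrightarrow> L2_norm M (\<lambda>x. T s f x - T t f x) < e / (L2_norm M g + 1)"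
    using semigroup_continuous[of t f "e / (L2_norm M g + 1)"] assms by auto
  have "\<bar>L2_inner M (T s f) g - L2_inner M (T t f) g\<bar> < e" if "s \<in> {0..1}" "\<bar>s - t\<bar> < d" for s
  proof -
    have L: "T s f \<in> L2 M" "T t f \<in> L2 M" using te that assms by (auto intro: semigroup_L2)
    let ?D = "\<lambda>x. T s f x - T t f x"
    have "L2_inner M (T s f) g - L2_inner M (T t f) g = L2_inner M ?D g"
      using L2_inner_add_left[OF L2_diff[OF L] L(2) assms(2)] by simp
    moreover have "\<bar>L2_inner M ?D g\<bar> \<le> L2_norm M ?D * L2_norm M g"
      by (intro L2_inner_le L2_diff L assms)
    moreover have "L2_norm M ?D * L2_norm M g \<le> L2_norm M ?D * (L2_norm M g + 1)"
      by (intro mult_left_mono) auto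
    moreover have "L2_norm M ?D * (L2_norm M g + 1) < e"
      using d(2)[of s] that by (simp add: pos_less_divide_eq add_nonneg_pos)
    ultimately show ?thesis by linarith
  qed
  then show "\<exists>d>0. \<forall>s\<in>{0..1}. dist s t < d \<longrightarrow> dist (L2_inner M (T s f) g) (L2_inner M (T t f) g) < e"
    using d(1) by (auto simp: dist_real_def)
qed

text \<open>With $w = T(s)u$, the right derivative of the squared norm is $2 (Lw, w) \le 0$.\<close>

lemma dissipative_orbit_norm_le:
  assumes dissipative: "\<And>v g. generator_graph M T v g \<Longrightarrow> L2_inner M g v \<le> 0"
    and gen: "generator_graph M T u f" and t: "0 \<le> t" "t \<le> 1"
  shows "L2_norm M (T t u) \<le> L2_norm M u"
proof -
  have uf: "u \<in> L2 M" "f \<in> L2 M" using gen by (auto simp: generator_graph_def)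
  have "(L2_norm M (T t u))\<^sup>2 \<le> (L2_norm M (T 0 u))\<^sup>2"
  proof (rule right_Dini_nonincreasing[OF t(1)])
    show "continuous_on {0..t} (\<lambda>t. (L2_norm M (T t u))\<^sup>2)"
      using t by (intro continuous_intros continuous_on_subset[OF continuous_on_L2_norm_orbit] uf) auto
    fix s e :: real assume s: "0 \<le> s" "s < t" "0 < e"
    let ?w = "T s u" and ?g = "T s f"
    have L: "?w \<in> L2 M" "?g \<in> L2 M" using uf s by (auto intro: semigroup_L2)
    from generator_expansion[OF gen s(1)] obtain r where
      r0: "((\<lambda>h. L2_norm M (r h)) \<longlongrightarrow> 0) (at_right 0)" and
      rL: "\<And>h. 0 < h \<Longrightarrow> r h \<in> L2 M" and
      r: "\<And>h. 0 < h \<Longrightarrow> AE x in M. T (s + h) u x = ?w x + of_real h * (?g x + r h x)"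
      by blast
    let ?E = "\<lambda>h. 2 * (L2_norm M (r h) * L2_norm M ?w) + h * (L2_norm M ?g + L2_norm M (r h))\<^sup>2"
    have est: "(L2_norm M (T (s + h) u))\<^sup>2 \<le> (L2_norm M ?w)\<^sup>2 + h * ?E h" if "0 < h" for h
    proof -
      let ?k = "\<lambda>x. ?g x + r h x"
      have k: "?k \<in> L2 M" by (intro L2_add L rL that)
      have "L2_norm M (T (s + h) u) = L2_norm M (\<lambda>x. ?w x + of_real h * ?k x)"
        using that s by (intro L2_norm_cong_AE r L2_measurable semigroup_L2 L2_add L2_scale L uf k) auto
      then have "(L2_norm M (T (s + h) u))\<^sup>2
          = (L2_norm M ?w)\<^sup>2 + 2 * (h * (L2_inner M ?g ?w + L2_inner M (r h) ?w)) + (h * L2_norm M ?k)\<^sup>2"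
        using that by (simp add: L2_norm_add_sq[OF L(1) L2_scale[OF k]] L2_inner_scale_left
          L2_norm_scale L2_inner_add_left[OF L(2) rL[OF that] L(1)])
      also have "\<dots> \<le> (L2_norm M ?w)\<^sup>2 + 2 * (h * (0 + L2_norm M (r h) * L2_norm M ?w))
          + (h * (L2_norm M ?g + L2_norm M (r h)))\<^sup>2"
      proof (intro add_mono mult_left_mono power_mono order_refl)
        show "L2_inner M ?g ?w \<le> 0" by (intro dissipative generator_shift gen s)
        show "L2_inner M (r h) ?w \<le> L2_norm M (r h) * L2_norm M ?w"
          using L2_inner_le[OF rL[OF that] L(1)] by simp
        show "L2_norm M ?k \<le> L2_norm M ?g + L2_norm M (r h)"
          by (intro L2_norm_triangle L rL that)
      qed (use that in auto)
      finally show ?thesis by (simp add: power2_eq_square algebra_simps)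
    qed
    have "(?E \<longlongrightarrow> 2 * (0 * L2_norm M ?w) + 0 * (L2_norm M ?g + 0)\<^sup>2) (at_right 0)"
      by (intro tendsto_intros r0)
    then have "\<forall>\<^sub>F h in at_right 0. ?E h < e"
      using s by (intro order_tendstoD(2)) auto
    moreover have "\<forall>\<^sub>F h in at_right 0. (0::real) < h"
      by (intro eventually_at_rightI[of 0 1]) auto
    ultimately show "\<forall>\<^sub>F h in at_right 0. (L2_norm M (T (s + h) u))\<^sup>2 \<le> (L2_norm M (T s u))\<^sup>2 + e * h"
    proof eventually_elim
      case (elim h)
      then have "h * ?E h \<le> h * e" by (intro mult_left_mono) auto
      with est[OF elim(2)] show ?case unfolding mult.commute[of e h] by linarith
    qed
  qed
  also have "L2_norm M (T 0 u) = L2_norm M u"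
    by (intro L2_norm_cong_AE L2_measurable semigroup_L2 semigroup_zero uf) auto
  finally show ?thesis by (rule power2_le_imp_le) simp
qed

text \<open>The derivative of $(T(t)u, u)$ is $(L T(t)u, u) = (T(t)u, Lu)$, which is at least
  $- \|u\| \|Lu\|$ because orbits in the domain have nonincreasing norm.\<close>

lemma symmetric_orbit_lower_bound:
  assumes dissipative: "\<And>v g. generator_graph M T v g \<Longrightarrow> L2_inner M g v \<le> 0"
    and symmetric: "\<And>v g. generator_graph M T v g \<Longrightarrow> L2_inner M g u = L2_inner M v f"
    and gen: "generator_graph M T u f" and t: "0 \<le> t" "t \<le> 1"
  shows "(L2_norm M u)\<^sup>2 - t * (L2_norm M u * L2_norm M f) \<le> L2_inner M (T t u) u"
proof -
  have uf: "u \<in> L2 M" "f \<in> L2 M" using gen by (auto simp: generator_graph_def)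
  let ?c = "L2_norm M u * L2_norm M f"
  have "- L2_inner M (T t u) u - ?c * t \<le> - L2_inner M (T 0 u) u - ?c * 0"
  proof (rule right_Dini_nonincreasing[OF t(1)])
    show "continuous_on {0..t} (\<lambda>t. - L2_inner M (T t u) u - ?c * t)"
      using t by (intro continuous_intros continuous_on_subset[OF continuous_on_L2_inner_orbit] uf) auto
    fix s e :: real assume s: "0 \<le> s" "s < t" "0 < e"
    let ?w = "T s u" and ?g = "T s f"
    have L: "?w \<in> L2 M" "?g \<in> L2 M" using uf s by (auto intro: semigroup_L2)
    from generator_expansion[OF gen s(1)] obtain r where
      r0: "((\<lambda>h. L2_norm M (r h)) \<longlongrightarrow> 0) (at_right 0)" and
      rL: "\<And>h. 0 < h \<Longrightarrow> r h \<in> L2 M" and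
      r: "\<And>h. 0 < h \<Longrightarrow> AE x in M. T (s + h) u x = ?w x + of_real h * (?g x + r h x)"
      by blast
    have "L2_inner M ?g u = L2_inner M ?w f" by (intro symmetric generator_shift gen s)
    moreover have "\<bar>L2_inner M ?w f\<bar> \<le> L2_norm M ?w * L2_norm M f" by (intro L2_inner_le L uf)
    moreover have "L2_norm M ?w * L2_norm M f \<le> ?c"
      using s t by (intro mult_right_mono dissipative_orbit_norm_le[OF dissipative gen]) auto
    ultimately have g: "- ?c \<le> L2_inner M ?g u" by linarith
    have est: "- L2_inner M (T (s + h) u) u - ?c * (s + h)
        \<le> - L2_inner M ?w u - ?c * s + h * (L2_norm M (r h) * L2_norm M u)" if "0 < h" for h
    proof -
      let ?k = "\<lambda>x. ?g x + r h x"
      have k: "?k \<in> L2 M" by (intro L2_add L rL that)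
      have "L2_inner M (T (s + h) u) u = L2_inner M (\<lambda>x. ?w x + of_real h * ?k x) u"
        using that s by (intro L2_inner_cong_AE r L2_measurable semigroup_L2 L2_add L2_scale L uf k) auto
      also have "\<dots> = L2_inner M ?w u + h * (L2_inner M ?g u + L2_inner M (r h) u)"
        by (simp add: L2_inner_add_left[OF L(1) L2_scale[OF k] uf(1)] L2_inner_scale_left
          L2_inner_add_left[OF L(2) rL[OF that] uf(1)])
      also have "\<dots> \<ge> L2_inner M ?w u + h * (- ?c + - (L2_norm M (r h) * L2_norm M u))"
        using L2_inner_le[OF rL[OF that] uf(1)] g that by (intro add_left_mono mult_left_mono add_mono) auto
      finally show ?thesis by (simp add: algebra_simps)
    qed
    have "((\<lambda>h. L2_norm M (r h) * L2_norm M u) \<longlongrightarrow> 0 * L2_norm M u) (at_right 0)"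
      by (intro tendsto_intros r0)
    then have "\<forall>\<^sub>F h in at_right 0. L2_norm M (r h) * L2_norm M u < e"
      using s by (intro order_tendstoD(2)) auto
    moreover have "\<forall>\<^sub>F h in at_right 0. (0::real) < h"
      by (intro eventually_at_rightI[of 0 1]) auto
    ultimately show "\<forall>\<^sub>F h in at_right 0. - L2_inner M (T (s + h) u) u - ?c * (s + h)
        \<le> - L2_inner M (T s u) u - ?c * s + e * h"
    proof eventually_elim
      case (elim h)
      then have "h * (L2_norm M (r h) * L2_norm M u) \<le> h * e" by (intro mult_left_mono) auto
      with est[OF elim(2)] show ?case unfolding mult.commute[of e h] by linarith
    qed
  qed
  also have "L2_inner M (T 0 u) u = L2_inner M u u"
    by (intro L2_inner_cong_AE L2_measurable semigroup_L2 semigroup_zero uf) auto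
  also have "L2_inner M u u = (L2_norm M u)\<^sup>2"
    unfolding L2_norm_sq L2_inner_def cmod_power2 by (simp add: power2_eq_square)
  finally show ?thesis by (simp add: algebra_simps)
qed

end

end

section \<open>Test functions and weak gradients\<close>

lemma partial_deriv_eq:
  "(\<phi> has_derivative D) (at x) \<Longrightarrow> partial_deriv i \<phi> x = D (axis i 1)"
  unfolding partial_deriv_def by (drule frechet_derivative_at) simp

lemma Cc1I:
  fixes \<phi> :: "real^'n \<Rightarrow> complex"
  assumes "\<And>x. (\<phi> has_derivative D x) (at x)" "\<And>i. continuous_on UNIV (\<lambda>x. D x (axis i 1))"
    and "compact K" "\<And>x. x \<notin> K \<Longrightarrow> \<phi> x = 0"
  shows "\<phi> \<in> Cc1"
proof -
  have "partial_deriv i \<phi> = (\<lambda>x. D x (axis i 1))" for i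
    using assms(1) by (intro ext partial_deriv_eq)
  moreover have "compact (closure {x. \<phi> x \<noteq> 0})"
    using assms(3,4) closure_minimal[of "{x. \<phi> x \<noteq> 0}" K]
    by (intro compact_closure[THEN iffD2] bounded_subset[OF compact_imp_bounded[OF assms(3)]]) auto
  ultimately show ?thesis
    using assms(1,2) by (auto simp: Cc1_def differentiable_def)
qed

lemma Cc1_has_derivative:
  "\<phi> \<in> Cc1 \<Longrightarrow> (\<phi> has_derivative frechet_derivative \<phi> (at x)) (at x)"
  by (auto simp: Cc1_def frechet_derivative_works)

lemma Cc1_continuous_partial: "\<phi> \<in> Cc1 \<Longrightarrow> continuous_on UNIV (partial_deriv i \<phi>)"
  by (simp add: Cc1_def)

lemma Cc1_continuous: "\<phi> \<in> Cc1 \<Longrightarrow> continuous_on UNIV \<phi>"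
  by (auto intro!: continuous_at_imp_continuous_on has_derivative_continuous[OF Cc1_has_derivative])

lemma Cc1_support:
  fixes \<phi> :: "real^'n \<Rightarrow> complex"
  assumes "\<phi> \<in> Cc1"
  obtains R where "0 < R" "\<And>x. x \<notin> cball 0 R \<Longrightarrow> \<phi> x = 0"
    "\<And>x i. x \<notin> cball 0 R \<Longrightarrow> partial_deriv i \<phi> x = 0"
proof -
  have "bounded (closure {x. \<phi> x \<noteq> 0})" using assms by (auto simp: Cc1_def compact_imp_bounded)
  then obtain R where "0 < R" and R: "\<And>x. x \<in> closure {x. \<phi> x \<noteq> 0} \<Longrightarrow> norm x \<le> R"
    by (auto simp: bounded_pos)
  have z: "\<phi> x = 0" if "x \<notin> cball 0 R" for x
    using R[of x] that closure_subset[of "{x. \<phi> x \<noteq> 0}"] by auto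
  have "partial_deriv i \<phi> x = 0" if "x \<notin> cball 0 R" for x i
  proof -
    have "(\<phi> has_derivative (\<lambda>_. 0)) (at x)"
    proof (rule has_derivative_transform_within_open)
      show "((\<lambda>_. 0) has_derivative (\<lambda>_. 0)) (at x)" by simp
      show "open (- cball 0 R :: (real^'n) set)" by (intro open_Compl closed_cball)
    qed (use that z in auto)
    from partial_deriv_eq[OF this] show ?thesis .
  qed
  with z \<open>0 < R\<close> show ?thesis by (intro that[of R])
qed

lemma Cc1_add:
  fixes \<phi> \<psi> :: "real^'n \<Rightarrow> complex"
  assumes "\<phi> \<in> Cc1" "\<psi> \<in> Cc1" shows "(\<lambda>x. \<phi> x + \<psi> x) \<in> Cc1"
proof -
  obtain R1 where R1: "0 < R1" "\<And>x. x \<notin> cball 0 R1 \<Longrightarrow> \<phi> x = 0"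
    "\<And>x i. x \<notin> cball 0 R1 \<Longrightarrow> partial_deriv i \<phi> x = 0"
    by (rule Cc1_support[OF assms(1)]) (rule that)
  obtain R2 where R2: "0 < R2" "\<And>x. x \<notin> cball 0 R2 \<Longrightarrow> \<psi> x = 0"
    "\<And>x i. x \<notin> cball 0 R2 \<Longrightarrow> partial_deriv i \<psi> x = 0"
    by (rule Cc1_support[OF assms(2)]) (rule that)
  show ?thesis
  proof (rule Cc1I[where K="cball 0 (max R1 R2)"])
    show "((\<lambda>x. \<phi> x + \<psi> x) has_derivative
        (\<lambda>h. frechet_derivative \<phi> (at x) h + frechet_derivative \<psi> (at x) h)) (at x)" for x
      by (intro has_derivative_add Cc1_has_derivative assms)
    show "continuous_on UNIV (\<lambda>x. frechet_derivative \<phi> (at x) (axis i 1) + frechet_derivative \<psi> (at x) (axis i 1))" for i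
      using Cc1_continuous_partial[OF assms(1), of i] Cc1_continuous_partial[OF assms(2), of i]
      unfolding partial_deriv_def[abs_def] by (rule continuous_on_add)
  qed (use R1 R2 in auto)
qed

lemma Cc1_cmult:
  fixes \<phi> :: "real^'n \<Rightarrow> complex"
  assumes "\<phi> \<in> Cc1" shows "(\<lambda>x. c * \<phi> x) \<in> Cc1"
proof -
  obtain R where R: "0 < R" "\<And>x. x \<notin> cball 0 R \<Longrightarrow> \<phi> x = 0"
    "\<And>x i. x \<notin> cball 0 R \<Longrightarrow> partial_deriv i \<phi> x = 0"
    by (rule Cc1_support[OF assms]) (rule that)
  show ?thesis
  proof (rule Cc1I[where K="cball 0 R"])
    show "((\<lambda>x. c * \<phi> x) has_derivative (\<lambda>h. c * frechet_derivative \<phi> (at x) h)) (at x)" for x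
      by (intro has_derivative_mult_right Cc1_has_derivative assms)
    show "continuous_on UNIV (\<lambda>x. c * frechet_derivative \<phi> (at x) (axis i 1))" for i
      using Cc1_continuous_partial[OF assms(1), of i]
      unfolding partial_deriv_def[abs_def] by (intro continuous_intros)
  qed (use R in auto)
qed

lemma Cc1_mult_has_derivative:
  assumes "\<phi> \<in> Cc1" "\<psi> \<in> Cc1"
  shows "((\<lambda>x. \<phi> x * \<psi> x) has_derivative
        (\<lambda>h. \<phi> x * frechet_derivative \<psi> (at x) h + frechet_derivative \<phi> (at x) h * \<psi> x)) (at x)"
  by (intro has_derivative_mult Cc1_has_derivative assms)

lemma partial_deriv_mult:
  assumes "\<phi> \<in> Cc1" "\<psi> \<in> Cc1"
  shows "partial_deriv i (\<lambda>x. \<phi> x * \<psi> x) x = \<phi> x * partial_deriv i \<psi> x + partial_deriv i \<phi> x * \<psi> x"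
  using partial_deriv_eq[OF Cc1_mult_has_derivative[OF assms]] by (simp add: partial_deriv_def)

lemma Cc1_mult:
  fixes \<phi> \<psi> :: "real^'n \<Rightarrow> complex"
  assumes "\<phi> \<in> Cc1" "\<psi> \<in> Cc1" shows "(\<lambda>x. \<phi> x * \<psi> x) \<in> Cc1"
proof -
  obtain R where R: "0 < R" "\<And>x. x \<notin> cball 0 R \<Longrightarrow> \<phi> x = 0"
    "\<And>x i. x \<notin> cball 0 R \<Longrightarrow> partial_deriv i \<phi> x = 0"
    by (rule Cc1_support[OF assms(1)]) (rule that)
  show ?thesis
  proof (rule Cc1I[OF Cc1_mult_has_derivative[OF assms], where K="cball 0 R"])
    show "continuous_on UNIV (\<lambda>x. \<phi> x * frechet_derivative \<psi> (at x) (axis i 1)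
        + frechet_derivative \<phi> (at x) (axis i 1) * \<psi> x)" for i
      using Cc1_continuous_partial[OF assms(1), of i] Cc1_continuous_partial[OF assms(2), of i]
        Cc1_continuous[OF assms(1)] Cc1_continuous[OF assms(2)]
      unfolding partial_deriv_def[abs_def] by (intro continuous_intros)
  qed (use R in auto)
qed

lemma continuous_imp_locally_integrable:
  "continuous_on UNIV f \<Longrightarrow> locally_integrable f"
  unfolding locally_integrable_def set_integrable_def
  by (auto intro!: borel_integrable_compact elim: continuous_on_subset)

lemma locally_integrable_measurable:
  fixes f :: "'a::euclidean_space \<Rightarrow> 'b::euclidean_space"
  assumes "locally_integrable f" shows "f \<in> borel_measurable borel"
proof (rule borel_measurable_LIMSEQ_metric)
  fix n :: nat
  have "integrable lborel (\<lambda>x. indicator (cball 0 (real n)) x *\<^sub>R f x)"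
    using assms by (auto simp: locally_integrable_def set_integrable_def)
  then show "(\<lambda>x. indicator (cball 0 (real n)) x *\<^sub>R f x) \<in> borel_measurable borel"
    by (auto dest: borel_measurable_integrable)
next
  fix x :: 'a
  obtain N :: nat where N: "norm x \<le> real N" using real_arch_simple by blast
  have "indicator (cball 0 (real n)) x *\<^sub>R f x = f x" if "N \<le> n" for n
    using N that by (auto simp: indicator_def)
  then have "\<forall>\<^sub>F n in sequentially. indicator (cball 0 (real n)) x *\<^sub>R f x = f x"
    by (auto simp: eventually_sequentially)
  then show "(\<lambda>n. indicator (cball 0 (real n)) x *\<^sub>R f x) \<longlonglongrightarrow> f x"
    by (rule tendsto_eventually)
qed

lemma locally_integrable_mult:
  fixes f \<phi> :: "'a::euclidean_space \<Rightarrow> complex"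
  assumes f: "locally_integrable f" and \<phi>: "continuous_on UNIV \<phi>" and K: "compact K" "\<And>x. x \<notin> K \<Longrightarrow> \<phi> x = 0"
  shows "integrable lborel (\<lambda>x. f x * \<phi> x)"
proof -
  have "bounded (\<phi> ` K)"
    using K(1) \<phi> by (intro compact_imp_bounded compact_continuous_image continuous_on_subset[OF \<phi>]) auto
  then obtain B where B: "\<And>x. x \<in> K \<Longrightarrow> norm (\<phi> x) \<le> B" by (auto simp: bounded_iff)
  have f': "integrable lborel (\<lambda>x. indicator K x *\<^sub>R f x)"
    using f K by (auto simp: locally_integrable_def set_integrable_def)
  show ?thesis
  proof (rule Bochner_Integration.integrable_bound)
    show "integrable lborel (\<lambda>x. B *\<^sub>R (indicator K x *\<^sub>R f x))"
      by (rule integrable_scaleR_right[OF f'])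
    show "(\<lambda>x. f x * \<phi> x) \<in> borel_measurable lborel"
      using locally_integrable_measurable[OF f] borel_measurable_continuous_onI[OF \<phi>] by simp
    have "norm (f x * \<phi> x) \<le> norm (B *\<^sub>R (indicator K x *\<^sub>R f x))" for x
    proof (cases "x \<in> K")
      case True
      then have "norm (f x) * norm (\<phi> x) \<le> norm (f x) * \<bar>B\<bar>"
        using B[of x] by (intro mult_left_mono) auto
      with True show ?thesis by (simp add: norm_mult mult.commute)
    qed (use K in simp)
    then show "AE x in lborel. norm (f x * \<phi> x) \<le> norm (B *\<^sub>R (indicator K x *\<^sub>R f x))" by simp
  qed
qed

lemma locally_integrable_mult_Cc1:
  assumes "locally_integrable f" "\<phi> \<in> Cc1"
  shows "integrable lborel (\<lambda>x. f x * \<phi> x)" "integrable lborel (\<lambda>x. f x * partial_deriv i \<phi> x)"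
proof -
  obtain R where "0 < R" "\<And>x. x \<notin> cball 0 R \<Longrightarrow> \<phi> x = 0"
    "\<And>x i. x \<notin> cball 0 R \<Longrightarrow> partial_deriv i \<phi> x = 0"
    by (rule Cc1_support[OF assms(2)]) (rule that)
  then show "integrable lborel (\<lambda>x. f x * \<phi> x)" "integrable lborel (\<lambda>x. f x * partial_deriv i \<phi> x)"
    by (auto intro!: locally_integrable_mult[where K="cball 0 R"] assms Cc1_continuous
        Cc1_continuous_partial)
qed

text \<open>By translation invariance of Lebesgue measure all difference quotients have integral zero. They
  are dominated by a constant on a ball, so the integral of their limit is zero as well.\<close>

lemma integral_partial_deriv:
  fixes \<phi> :: "real^'n \<Rightarrow> complex"
  assumes "\<phi> \<in> Cc1" shows "(\<integral>x. partial_deriv i \<phi> x \<partial>lborel) = 0"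
proof -
  obtain R where "0 < R" and R: "\<And>x. x \<notin> cball 0 R \<Longrightarrow> \<phi> x = 0"
    "\<And>x i. x \<notin> cball 0 R \<Longrightarrow> partial_deriv i \<phi> x = 0"
    by (rule Cc1_support[OF assms]) (rule that)
  have "bounded (partial_deriv i \<phi> ` cball 0 R)"
    by (intro compact_imp_bounded compact_continuous_image
        continuous_on_subset[OF Cc1_continuous_partial[OF assms]]) auto
  then obtain B where "0 < B" "\<forall>y \<in> partial_deriv i \<phi> ` cball 0 R. norm y \<le> B"
    unfolding bounded_pos by blast
  then have B: "\<And>x. x \<in> cball 0 R \<Longrightarrow> norm (partial_deriv i \<phi> x) \<le> B" "0 < B" by blast+
  then have B': "norm (partial_deriv i \<phi> x) \<le> B" for x
    using R(2)[of x] by (cases "x \<in> cball 0 R") auto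
  define a where "a n = (1 / real (Suc n))" for n
  have a: "0 < a n" "a n \<le> 1" for n by (auto simp: a_def)
  have a0: "a \<longlonglongrightarrow> 0" unfolding a_def[abs_def] using LIMSEQ_inverse_real_of_nat by (simp add: inverse_eq_divide)
  let ?e = "axis i 1 :: real^'n"
  have deriv: "((\<lambda>s. \<phi> (x + s *\<^sub>R ?e)) has_derivative (\<lambda>h. h *\<^sub>R partial_deriv i \<phi> (x + s *\<^sub>R ?e))) (at s)" for x s
  proof -
    have "((\<lambda>s. \<phi> (x + s *\<^sub>R ?e)) has_derivative (\<lambda>h. frechet_derivative \<phi> (at (x + s *\<^sub>R ?e)) (h *\<^sub>R ?e))) (at s)"
      by (rule has_derivative_compose[OF _ Cc1_has_derivative[OF assms]]) (auto intro!: derivative_eq_intros)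
    moreover have "frechet_derivative \<phi> (at y) (h *\<^sub>R ?e) = h *\<^sub>R partial_deriv i \<phi> y" for h y
      using linear_scale[OF has_derivative_linear[OF Cc1_has_derivative[OF assms]]]
      by (simp add: partial_deriv_def)
    ultimately show ?thesis by simp
  qed
  have cont: "\<phi> \<in> borel_measurable borel"
    using Cc1_continuous[OF assms] by (rule borel_measurable_continuous_onI)
  have int: "integrable lborel \<phi>"
    using locally_integrable_mult_Cc1(1)[OF continuous_imp_locally_integrable[of "\<lambda>_. 1"] assms] by simp
  have int': "integrable lborel (\<lambda>x. \<phi> (x + v))" "(\<integral>x. \<phi> (x + v) \<partial>lborel) = (\<integral>x. \<phi> x \<partial>lborel)" for v
  proof -
    have "integrable (distr lborel borel ((+) v)) \<phi>" using int by (simp only: lborel_distr_plus)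
    then show "integrable lborel (\<lambda>x. \<phi> (x + v))"
      by (subst (asm) integrable_distr_eq) (auto simp: add.commute cont)
    have "(\<integral>x. \<phi> x \<partial>lborel) = (\<integral>x. \<phi> x \<partial>distr lborel borel ((+) v))" by (simp only: lborel_distr_plus)
    also have "\<dots> = (\<integral>x. \<phi> (x + v) \<partial>lborel)"
      by (subst integral_distr) (auto simp: add.commute cont)
    finally show "(\<integral>x. \<phi> (x + v) \<partial>lborel) = (\<integral>x. \<phi> x \<partial>lborel)" by simp
  qed
  let ?q = "\<lambda>n x. (1 / a n) *\<^sub>R (\<phi> (x + a n *\<^sub>R ?e) - \<phi> x)"
  have "(\<lambda>n. \<integral>x. ?q n x \<partial>lborel) \<longlonglongrightarrow> (\<integral>x. partial_deriv i \<phi> x \<partial>lborel)"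
  proof (rule integral_dominated_convergence[where w="\<lambda>x. B * indicator (cball 0 (R + 1)) x"])
    show "partial_deriv i \<phi> \<in> borel_measurable lborel"
      using Cc1_continuous_partial[OF assms] by (simp add: borel_measurable_continuous_onI)
    show "?q n \<in> borel_measurable lborel" for n using cont by measurable
    show "integrable lborel (\<lambda>x. B * indicator (cball 0 (R + 1)) x :: real)"
      by (intro integrable_mult_right integrable_real_indicator) (use emeasure_lborel_cball_finite in \<open>auto simp: top.not_eq_extremum\<close>)
    show "AE x in lborel. (\<lambda>n. ?q n x) \<longlonglongrightarrow> partial_deriv i \<phi> x"
    proof (rule AE_I2)
      fix x
      let ?g = "\<lambda>s. \<phi> (x + s *\<^sub>R ?e)" and ?d = "partial_deriv i \<phi> x"
      have "(?g has_derivative (\<lambda>h. h *\<^sub>R ?d)) (at 0)" using deriv[of x 0] by simp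
      then have lim: "((\<lambda>h. norm (?g (0 + h) - ?g 0 - h *\<^sub>R ?d) / norm h) \<longlongrightarrow> 0) (at 0)"
        by (simp only: has_derivative_at)
      have quot: "norm (?g (0 + h) - ?g 0 - h *\<^sub>R ?d) / norm h
          = norm ((\<phi> (x + h *\<^sub>R ?e) - \<phi> x) /\<^sub>R h - ?d)" if "h \<noteq> 0" for h
      proof -
        have "(\<phi> (x + h *\<^sub>R ?e) - \<phi> x) /\<^sub>R h - ?d = (?g (0 + h) - ?g 0 - h *\<^sub>R ?d) /\<^sub>R h"
          using that by (simp add: scaleR_diff_right)
        then show ?thesis by (simp add: divide_inverse mult.commute)
      qed
      have "((\<lambda>h. norm ((\<phi> (x + h *\<^sub>R ?e) - \<phi> x) /\<^sub>R h - ?d)) \<longlongrightarrow> 0) (at 0)"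
        by (rule iffD1[OF LIM_equal lim]) (use quot in blast)
      then have "((\<lambda>h. (\<phi> (x + h *\<^sub>R ?e) - \<phi> x) /\<^sub>R h) \<longlongrightarrow> ?d) (at 0)"
        by (simp only: tendsto_norm_zero_iff LIM_zero_iff)
      moreover have "filterlim a (at 0) sequentially"
        unfolding filterlim_at using a0 a(1) by (auto simp: less_imp_neq[OF a(1), symmetric])
      ultimately have "(\<lambda>n. (\<phi> (x + a n *\<^sub>R ?e) - \<phi> x) /\<^sub>R a n) \<longlonglongrightarrow> partial_deriv i \<phi> x"
        by (rule filterlim_compose)
      then show "(\<lambda>n. ?q n x) \<longlonglongrightarrow> partial_deriv i \<phi> x"
        by (simp add: inverse_eq_divide)
    qed
    show "AE x in lborel. norm (?q n x) \<le> B * indicator (cball 0 (R + 1)) x" for n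
    proof (rule AE_I2)
      fix x
      show "norm (?q n x) \<le> B * indicator (cball 0 (R + 1)) x"
      proof (cases "x \<in> cball 0 (R + 1)")
        case True
        have "norm (\<phi> (x + a n *\<^sub>R ?e) - \<phi> (x + 0 *\<^sub>R ?e)) \<le> B * norm (a n - 0)"
        proof (rule differentiable_bound[where S=UNIV])
          show "((\<lambda>s. \<phi> (x + s *\<^sub>R ?e)) has_derivative (\<lambda>h. h *\<^sub>R partial_deriv i \<phi> (x + s *\<^sub>R ?e))) (at s within UNIV)" for s
            by (rule deriv)
          show "onorm (\<lambda>h::real. h *\<^sub>R partial_deriv i \<phi> (x + s *\<^sub>R ?e)) \<le> B" for s
            using B'[of "x + s *\<^sub>R ?e"] by (intro onorm_le) (simp add: mult.commute[of B] mult_left_mono)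
        qed auto
        then have "norm (\<phi> (x + a n *\<^sub>R ?e) - \<phi> x) \<le> B * a n" using a[of n] by simp
        moreover have "norm (?q n x) = norm (\<phi> (x + a n *\<^sub>R ?e) - \<phi> x) / a n"
          unfolding norm_scaleR using a[of n] by simp
        ultimately have "norm (?q n x) \<le> B" using a[of n] by (simp only: pos_divide_le_eq)
        then show ?thesis using True by (simp only: indicator_simps mult_1_right)
      next
        case False
        then have "R + 1 < norm x" by simp
        moreover have "norm x \<le> norm (x + a n *\<^sub>R ?e) + norm (a n *\<^sub>R ?e)"
          by (metis add_diff_cancel_right' norm_triangle_ineq4)
        moreover have "norm (a n *\<^sub>R ?e) \<le> 1" using a[of n] by (simp add: norm_axis_1)
        ultimately have "\<phi> (x + a n *\<^sub>R ?e) = 0" "\<phi> x = 0" by (auto intro!: R)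
        then show ?thesis using B by simp
      qed
    qed
  qed
  moreover have "(\<lambda>n. \<integral>x. ?q n x \<partial>lborel) = (\<lambda>_. 0)"
    using int' int by (intro ext) simp
  ultimately show ?thesis by (metis LIMSEQ_unique tendsto_const)
qed

lemma Cc1_has_weak_gradient:
  fixes u :: "real^'n \<Rightarrow> complex"
  assumes "u \<in> Cc1" shows "has_weak_gradient u (\<lambda>x. \<chi> i. partial_deriv i u x)"
  unfolding has_weak_gradient_def
proof (intro conjI ballI allI)
  show "locally_integrable u" by (intro continuous_imp_locally_integrable Cc1_continuous assms)
  show "locally_integrable (\<lambda>x. \<chi> i. partial_deriv i u x)"
    by (intro continuous_imp_locally_integrable continuous_on_vec_lambda Cc1_continuous_partial assms)
  fix \<phi> :: "real^'n \<Rightarrow> complex" and i assume "\<phi> \<in> Cc1"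
  have "0 = (\<integral>x. u x * partial_deriv i \<phi> x + partial_deriv i u x * \<phi> x \<partial>lborel)"
    using integral_partial_deriv[OF Cc1_mult[OF assms \<open>\<phi> \<in> Cc1\<close>], of i]
    by (simp add: partial_deriv_mult[OF assms \<open>\<phi> \<in> Cc1\<close>])
  also have "\<dots> = (\<integral>x. u x * partial_deriv i \<phi> x \<partial>lborel) + (\<integral>x. partial_deriv i u x * \<phi> x \<partial>lborel)"
    by (intro Bochner_Integration.integral_add locally_integrable_mult_Cc1
      continuous_imp_locally_integrable Cc1_continuous Cc1_continuous_partial assms \<open>\<phi> \<in> Cc1\<close>)
  finally show "(\<integral>x. u x * partial_deriv i \<phi> x \<partial>lborel) = - (\<integral>x. (\<chi> i. partial_deriv i u x) $ i * \<phi> x \<partial>lborel)"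
    by (simp add: eq_neg_iff_add_eq_0)
qed

text \<open>The power \<open>k\<close> is of class $C^{k-1}$ across the sphere, and its derivatives are expressed by lower
  powers. The case \<open>k = 3\<close> provides test functions with two continuous derivatives.\<close>

definition bump :: "nat \<Rightarrow> real^'n \<Rightarrow> real \<Rightarrow> real^'n \<Rightarrow> real" where
  "bump k c r x = max 0 (1 - (norm (x - c))\<^sup>2 / r\<^sup>2) ^ k"

lemma DERIV_max_power:
  assumes "2 \<le> k"
  shows "((\<lambda>s::real. max 0 s ^ k) has_real_derivative real k * max 0 s ^ (k - 1)) (at s)"
proof -
  consider "0 < s" | "s < 0" | "s = 0" by linarith
  then show ?thesis
  proof cases
    case 1
    have "((\<lambda>s. s ^ k) has_real_derivative real k * max 0 s ^ (k - 1)) (at s)"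
      using 1 by (auto intro!: derivative_eq_intros)
    then show ?thesis
      by (rule has_field_derivative_transform_within_open[where S="{0<..}"]) (use 1 in auto)
  next
    case 2
    have "((\<lambda>s. 0) has_real_derivative real k * max 0 s ^ (k - 1)) (at s)"
      using 2 assms by (auto intro!: derivative_eq_intros)
    then show ?thesis
      by (rule has_field_derivative_transform_within_open[where S="{..<0}"]) (use 2 assms in auto)
  next
    case 3
    have "((\<lambda>h::real. max 0 h ^ (k - 1)) \<longlongrightarrow> max 0 0 ^ (k - 1)) (at 0)"
      by (intro tendsto_intros)
    moreover have "max 0 0 ^ (k - 1) = (0::real)" using assms by simp
    ultimately have lim: "((\<lambda>h::real. max 0 h ^ (k - 1)) \<longlongrightarrow> 0) (at 0)" by (simp only:)
    have "max 0 h ^ k / h = max 0 h ^ (k - 1)" if "h \<noteq> 0" for h :: real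
      using that assms by (cases "0 < h") (auto simp: power_eq_if max_def)
    then have "((\<lambda>h::real. max 0 h ^ k / h) \<longlongrightarrow> 0) (at 0)"
      by (intro iffD1[OF LIM_equal lim]) simp
    moreover have "k \<noteq> 0" "k - Suc 0 \<noteq> 0" using assms by auto
    ultimately show ?thesis using 3 by (simp add: DERIV_def power_0_left)
  qed
qed

lemma has_derivative_bump:
  fixes c :: "real^'n"
  assumes "2 \<le> k"
  shows "(bump k c r has_derivative
    (\<lambda>h. real k * bump (k - 1) c r x * (- 2 * ((x - c) \<bullet> h) / r\<^sup>2))) (at x)"
proof -
  have "((\<lambda>x. 1 - (norm (x - c))\<^sup>2 / r\<^sup>2) has_derivative (\<lambda>h. - 2 * ((x - c) \<bullet> h) / r\<^sup>2)) (at x)"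
    unfolding power2_norm_eq_inner divide_inverse
    by (auto intro!: derivative_eq_intros simp: inner_commute)
  from has_derivative_compose[OF this DERIV_max_power[OF assms, THEN has_field_derivative_imp_has_derivative]]
  show ?thesis by (simp add: bump_def[abs_def])
qed

lemma continuous_on_bump: "continuous_on A (bump k c r)"
  unfolding bump_def[abs_def] by (cases "r = 0") (auto intro!: continuous_intros)

lemma bump_bounds: "0 \<le> bump k c r x" "bump k c r x \<le> 1"
  unfolding bump_def by (auto intro!: power_le_one)

lemma bump_eq_0_iff: "0 < k \<Longrightarrow> 0 < r \<Longrightarrow> bump k c r x = 0 \<longleftrightarrow> x \<notin> ball c r"
  using abs_le_square_iff[of r "norm (x - c)"]
  by (auto simp: bump_def dist_norm norm_minus_commute max_def not_le)

lemma bump_eq_0: "0 < k \<Longrightarrow> 0 < r \<Longrightarrow> x \<notin> cball c r \<Longrightarrow> bump k c r x = 0"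
  by (subst bump_eq_0_iff) auto

lemma bump_Cc1:
  fixes c :: "real^'n"
  assumes "2 \<le> k" "0 < r"
  shows "(\<lambda>x. complex_of_real (bump k c r x)) \<in> Cc1"
    and "partial_deriv i (\<lambda>x. complex_of_real (bump k c r x)) x
      = complex_of_real (- 2 * real k / r\<^sup>2 * (bump (k - 1) c r x * (x $ i - c $ i)))"
proof -
  have d: "((\<lambda>x. complex_of_real (bump k c r x)) has_derivative
    (\<lambda>h. complex_of_real (real k * bump (k - 1) c r x * (- 2 * ((x - c) \<bullet> h) / r\<^sup>2)))) (at x)" for x
    by (intro has_derivative_of_real has_derivative_bump assms)
  show "(\<lambda>x. complex_of_real (bump k c r x)) \<in> Cc1"
    by (rule Cc1I[OF d, where K="cball c r"])
      (use assms in \<open>auto intro!: continuous_intros continuous_on_bump simp: inner_axis bump_eq_0\<close>)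
  show "partial_deriv i (\<lambda>x. complex_of_real (bump k c r x)) x
      = complex_of_real (- 2 * real k / r\<^sup>2 * (bump (k - 1) c r x * (x $ i - c $ i)))"
    by (subst partial_deriv_eq[OF d], rule arg_cong[where f=complex_of_real])
      (simp add: inner_axis algebra_simps add_divide_distrib diff_divide_distrib)
qed

lemma bump_partial_Cc1:
  fixes c :: "real^'n"
  assumes "3 \<le> k" "0 < r"
  defines "\<psi> \<equiv> \<lambda>i x. partial_deriv i (\<lambda>x. complex_of_real (bump k c r x)) x"
  shows "\<psi> i \<in> Cc1"
    and "(\<Sum>i\<in>UNIV. partial_deriv i (\<psi> i) x) = complex_of_real (- 2 * real k / r\<^sup>2 *
      (real CARD('n) * bump (k - 1) c r x - 2 * real (k - 1) / r\<^sup>2 * bump (k - 2) c r x * (norm (x - c))\<^sup>2))"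
proof -
  have \<psi>: "\<psi> = (\<lambda>i x. complex_of_real (- 2 * real k / r\<^sup>2 * (bump (k - 1) c r x * (x $ i - c $ i))))"
    unfolding \<psi>_def
  proof (intro ext)
    fix i x
    show "partial_deriv i (\<lambda>x. complex_of_real (bump k c r x)) x
      = complex_of_real (- 2 * real k / r\<^sup>2 * (bump (k - 1) c r x * (x $ i - c $ i)))"
      by (rule bump_Cc1(2)) (use assms in auto)
  qed
  have d: "(\<psi> i has_derivative (\<lambda>h. complex_of_real (- 2 * real k / r\<^sup>2 * (bump (k - 1) c r x * (h $ i)
      + (real (k - 1) * bump (k - 1 - 1) c r x * (- 2 * ((x - c) \<bullet> h) / r\<^sup>2)) * (x $ i - c $ i))))) (at x)" for x i
  proof -
    have "((\<lambda>x. x $ i - c $ i) has_derivative (\<lambda>h. h $ i)) (at x)"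
      by (auto intro!: derivative_eq_intros bounded_linear.has_derivative[OF bounded_linear_vec_nth])
    then show ?thesis
      unfolding \<psi> using assms
      by (intro has_derivative_of_real has_derivative_mult_right has_derivative_mult has_derivative_bump) auto
  qed
  show "\<psi> i \<in> Cc1"
  proof (rule Cc1I[OF d, where K="cball c r"])
    show "continuous_on UNIV (\<lambda>x. complex_of_real (- 2 * real k / r\<^sup>2 * (bump (k - 1) c r x * (axis j 1 $ i)
      + (real (k - 1) * bump (k - 1 - 1) c r x * (- 2 * ((x - c) \<bullet> axis j 1) / r\<^sup>2)) * (x $ i - c $ i))))" for j
      using assms by (auto intro!: continuous_intros continuous_on_bump continuous_on_component)
  qed (use assms(1,2) in \<open>auto simp: \<psi> bump_eq_0\<close>)
  have p: "partial_deriv i (\<psi> i) x = complex_of_real (- 2 * real k / r\<^sup>2 * (bump (k - 1) c r x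
      - 2 * real (k - 1) / r\<^sup>2 * bump (k - 2) c r x * ((x - c) $ i)\<^sup>2))" for i
  proof -
    have alg: "- 2 * K / R * (b * 1 + (K' * b' * (- 2 * y / R)) * y) = - 2 * K / R * (b - 2 * K' / R * b' * y\<^sup>2)"
      for K K' R b b' y :: real
      by (simp add: power2_eq_square algebra_simps)
    have "(x - c) \<bullet> axis i 1 = (x - c) $ i" "x $ i - c $ i = (x - c) $ i" "k - 1 - 1 = k - 2" "axis i (1::real) $ i = 1"
      by (simp_all add: inner_axis)
    then show ?thesis
      by (subst partial_deriv_eq[OF d]) (simp only: alg)
  qed
  have n: "(norm (x - c))\<^sup>2 = (\<Sum>i\<in>UNIV. ((x - c) $ i)\<^sup>2)"
    unfolding power2_norm_eq_inner inner_vec_def by (simp add: power2_eq_square)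
  show "(\<Sum>i\<in>UNIV. partial_deriv i (\<psi> i) x) = complex_of_real (- 2 * real k / r\<^sup>2 *
      (real CARD('n) * bump (k - 1) c r x - 2 * real (k - 1) / r\<^sup>2 * bump (k - 2) c r x * (norm (x - c))\<^sup>2))"
    unfolding p n of_real_sum[symmetric] sum_distrib_left[symmetric] sum_subtractf by simp
qed

text \<open>The sets where a test function $\psi$ with values in $[0,1]$ does not vanish are stable under
  intersection, since test functions can be multiplied, and generate the Borel sets, since they
  include the balls. The indicator of such a set is the limit of the test functions
  $1 - (1 - \psi)^k$, so \<open>f\<close>, localized by a fixed bump, has integral zero over each of them and
  hence over every Borel set.\<close>

lemma integral_Cc1_eq_0_imp_AE_0:
  fixes f :: "real^'n \<Rightarrow> complex"
  assumes f: "locally_integrable f" and zero: "\<And>\<phi>. \<phi> \<in> Cc1 \<Longrightarrow> (\<integral>x. f x * \<phi> x \<partial>lborel) = 0"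
  shows "AE x in lborel. f x = 0"
proof -
  define W where "W = {\<psi> :: real^'n \<Rightarrow> real. (\<forall>x. 0 \<le> \<psi> x \<and> \<psi> x \<le> 1) \<and> (\<lambda>x. complex_of_real (\<psi> x)) \<in> Cc1}"
  define E where "E = {{x. \<psi> x \<noteq> 0} | \<psi>. \<psi> \<in> W}"
  have bumpW: "bump 3 c r \<in> W" if "0 < r" for c r
    using that by (auto simp: W_def bump_bounds intro!: bump_Cc1)
  have cont: "continuous_on UNIV \<psi>" if "\<psi> \<in> W" for \<psi>
  proof -
    have "continuous_on UNIV (\<lambda>x. Re (complex_of_real (\<psi> x)))"
      using that by (intro continuous_on_Re Cc1_continuous) (auto simp: W_def)
    then show ?thesis by simp
  qed
  have stable: "Int_stable E"
  proof (rule Int_stableI)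
    fix a b assume "a \<in> E" "b \<in> E"
    then obtain \<psi> \<eta> where *: "a = {x. \<psi> x \<noteq> 0}" "b = {x. \<eta> x \<noteq> 0}" "\<psi> \<in> W" "\<eta> \<in> W"
      by (auto simp: E_def)
    then have "(\<lambda>x. \<psi> x * \<eta> x) \<in> W"
      using Cc1_mult[of "\<lambda>x. complex_of_real (\<psi> x)" "\<lambda>x. complex_of_real (\<eta> x)"]
      by (auto simp: W_def intro: mult_le_one)
    then show "a \<inter> b \<in> E" unfolding E_def using * by (intro CollectI exI[of _ "\<lambda>x. \<psi> x * \<eta> x"]) auto
  qed
  have gen: "sets borel = sigma_sets UNIV E"
  proof
    have "E \<subseteq> sets borel"
    proof
      fix A assume "A \<in> E"
      then obtain \<psi> where "\<psi> \<in> W" "A = {x. \<psi> x \<noteq> 0}" by (auto simp: E_def)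
      then show "A \<in> sets borel"
        using open_Collect_neq[OF cont continuous_on_const, of \<psi> 0] by simp
    qed
    then show "sigma_sets UNIV E \<subseteq> sets borel"
      using sets.sigma_sets_subset[of E borel] by simp
    have "S \<in> sigma_sets UNIV E" if "open S" for S :: "(real^'n) set"
    proof -
      define F where "F = {ball c r | c r. 0 < r \<and> ball c r \<subseteq> S}"
      have opn: "open A" if "A \<in> F" for A using that by (auto simp: F_def)
      obtain F' where F': "F' \<subseteq> F" "countable F'" "\<Union>F' = \<Union>F"
        by (rule Lindelof[OF opn]) (assumption, rule that)
      have "\<Union>F = S"
      proof
        show "S \<subseteq> \<Union>F"
        proof
          fix x assume "x \<in> S"
          then obtain e where "0 < e" "ball x e \<subseteq> S" using \<open>open S\<close> openE by blast
          then have "ball x e \<in> F" "x \<in> ball x e" by (auto simp: F_def)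
          then show "x \<in> \<Union>F" by blast
        qed
      qed (auto simp: F_def)
      moreover have "\<Union>F' \<in> sigma_sets UNIV E"
      proof (intro sigma_sets_UNION F'(2))
        fix b assume "b \<in> F'"
        then obtain c r where "0 < r" "b = ball c r" using F' by (auto simp: F_def)
        then have "b = {x. bump 3 c r x \<noteq> 0}" by (auto simp: bump_eq_0_iff)
        then show "b \<in> sigma_sets UNIV E" using bumpW[OF \<open>0 < r\<close>] by (auto simp: E_def)
      qed
      ultimately show ?thesis using F' by simp
    qed
    then show "sets borel \<subseteq> sigma_sets UNIV E"
      unfolding borel_def by (subst sets_measure_of) (auto intro!: sigma_sets_mono)
  qed
  have local: "AE x in lborel. complex_of_real (bump 3 0 r x) * f x = 0" if "0 < r" for r :: real
  proof -
    let ?\<rho> = "\<lambda>x. complex_of_real (bump 3 0 r x)"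
    let ?F = "\<lambda>x. ?\<rho> x * f x"
    have \<rho>: "?\<rho> \<in> Cc1" using that by (intro bump_Cc1) auto
    have F: "integrable lborel ?F"
      using locally_integrable_mult_Cc1(1)[OF f \<rho>] by (simp add: mult.commute)
    have F0: "(\<integral>x. ?F x \<partial>lborel) = 0" using zero[OF \<rho>] by (simp add: mult.commute)
    have sets_zero: "(\<integral>x. indicator A x *\<^sub>R ?F x \<partial>lborel) = 0" if "A \<in> sigma_sets UNIV E" for A
      using stable subset_UNIV[of E, folded Pow_UNIV] that
    proof (induction rule: sigma_sets_induct_disjoint)
      case (basic A)
      then obtain \<psi> where \<psi>: "\<psi> \<in> W" and A: "A = {x. \<psi> x \<noteq> 0}" by (auto simp: E_def)
      define \<eta> where "\<eta> k x = 1 - (1 - \<psi> x) ^ k" for k :: nat and x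
      have \<psi>01: "0 \<le> \<psi> x" "\<psi> x \<le> 1" for x using \<psi> by (auto simp: W_def)
      have \<eta>: "(\<lambda>x. complex_of_real (\<eta> k x)) \<in> Cc1" for k
      proof (induction k)
        case 0
        show ?case using Cc1_cmult[OF \<rho>, of 0] by (simp add: \<eta>_def)
      next
        case (Suc k)
        let ?a = "\<lambda>x. complex_of_real (\<eta> k x)" and ?b = "\<lambda>x. complex_of_real (\<psi> x)"
        have "?b \<in> Cc1" using \<psi> by (simp add: W_def)
        then have "(\<lambda>x. (?a x + ?b x) + (- 1) * (?a x * ?b x)) \<in> Cc1"
          by (intro Cc1_add Cc1_cmult Cc1_mult Suc)
        moreover have "(?a x + ?b x) + (- 1) * (?a x * ?b x) = complex_of_real (\<eta> (Suc k) x)" for x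
          by (simp add: \<eta>_def algebra_simps)
        ultimately show ?case by simp
      qed
      have "(\<lambda>k. \<integral>x. \<eta> k x *\<^sub>R ?F x \<partial>lborel) \<longlonglongrightarrow> (\<integral>x. indicator A x *\<^sub>R ?F x \<partial>lborel)"
      proof (rule integral_dominated_convergence[where w="\<lambda>x. norm (?F x)"])
        have "A \<in> sets borel" unfolding A using open_Collect_neq[OF cont[OF \<psi>] continuous_on_const] by simp
        then show "(\<lambda>x. indicator A x *\<^sub>R ?F x) \<in> borel_measurable lborel"
          using borel_measurable_integrable[OF F] by simp
        show "(\<lambda>x. \<eta> k x *\<^sub>R ?F x) \<in> borel_measurable lborel" for k
          using borel_measurable_integrable[OF F] borel_measurable_continuous_onI[OF cont[OF \<psi>]]
          unfolding \<eta>_def by simp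
        show "integrable lborel (\<lambda>x. norm (?F x))" using F by (rule integrable_norm)
        show "AE x in lborel. (\<lambda>k. \<eta> k x *\<^sub>R ?F x) \<longlonglongrightarrow> indicator A x *\<^sub>R ?F x"
        proof (rule AE_I2)
          fix x
          have "(\<lambda>k. \<eta> k x) \<longlonglongrightarrow> indicator A x"
          proof (cases "\<psi> x = 0")
            case True
            then show ?thesis by (simp add: \<eta>_def A)
          next
            case False
            have "(\<lambda>k. 1 - (1 - \<psi> x) ^ k) \<longlonglongrightarrow> 1 - 0"
              using False \<psi>01[of x] by (intro tendsto_intros LIMSEQ_realpow_zero) auto
            then show ?thesis using False by (simp add: \<eta>_def A)
          qed
          then show "(\<lambda>k. \<eta> k x *\<^sub>R ?F x) \<longlonglongrightarrow> indicator A x *\<^sub>R ?F x" by (intro tendsto_intros)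
        qed
        have "norm (\<eta> k x *\<^sub>R ?F x) \<le> norm (?F x)" for k x
        proof -
          have "\<bar>\<eta> k x\<bar> \<le> 1" using \<psi>01[of x] power_le_one[of "1 - \<psi> x" k] by (auto simp: \<eta>_def)
          then show ?thesis by (simp add: mult_left_le_one_le)
        qed
        then show "AE x in lborel. norm (\<eta> k x *\<^sub>R ?F x) \<le> norm (?F x)" for k by simp
      qed
      moreover have "(\<integral>x. \<eta> k x *\<^sub>R ?F x \<partial>lborel) = 0" for k
        using zero[OF Cc1_mult[OF \<rho> \<eta>[of k]]] by (simp add: scaleR_conv_of_real mult_ac)
      ultimately show ?case by (simp add: LIMSEQ_const_iff)
    next
      case (compl A)
      have A: "A \<in> sets borel" using compl gen by simp
      have "(\<integral>x. indicator (UNIV - A) x *\<^sub>R ?F x \<partial>lborel) = (\<integral>x. ?F x - indicator A x *\<^sub>R ?F x \<partial>lborel)"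
        by (intro Bochner_Integration.integral_cong) (auto simp: indicator_def)
      also have "\<dots> = 0"
        using F F0 compl A integrable_mult_indicator[OF _ F, of A] by simp
      finally show ?case .
    next
      case (union A)
      have A: "A i \<in> sets borel" for i using union gen by auto
      have "(\<integral>x. indicator (\<Union>i. A i) x *\<^sub>R ?F x \<partial>lborel) = (\<Sum>i. \<integral>x. indicator (A i) x *\<^sub>R ?F x \<partial>lborel)"
        using lebesgue_integral_countable_add[of A lborel ?F] A union(1) integrable_mult_indicator[OF _ F, of "\<Union>i. A i"]
        by (auto simp: set_lebesgue_integral_def set_integrable_def disjoint_family_on_def)
      then show ?case using union by simp
    qed auto
    have "AE x in lborel. ?F x = 0"
    proof (rule sigma_finite_measure.density_unique_banach[OF sigma_finite_lborel])
      show "set_lebesgue_integral lborel A ?F = set_lebesgue_integral lborel A (\<lambda>_. 0)" if "A \<in> sets lborel" for A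
        using sets_zero[of A] that gen by (simp add: set_lebesgue_integral_def)
    qed (use F in auto)
    then show ?thesis .
  qed
  have "AE x in lborel. \<forall>n. complex_of_real (bump 3 0 (real (Suc n)) x) * f x = 0"
    unfolding AE_all_countable using local by auto
  then show ?thesis
  proof eventually_elim
    case (elim x)
    obtain n where "norm x \<le> real n" using real_arch_simple by blast
    then have "bump 3 0 (real (Suc n)) x \<noteq> 0" by (subst bump_eq_0_iff) auto
    then show ?case using elim by (auto dest: spec[of _ n])
  qed
qed

lemma weak_gradient_component_locally_integrable:
  fixes u :: "real^'n \<Rightarrow> complex"
  assumes "has_weak_gradient u g" shows "locally_integrable (\<lambda>x. g x $ i)"
  unfolding locally_integrable_def set_integrable_def
proof (intro allI impI)
  fix K :: "(real^'n) set" assume "compact K"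
  then have "integrable lborel (\<lambda>x. indicator K x *\<^sub>R g x)"
    using assms by (simp add: has_weak_gradient_def locally_integrable_def set_integrable_def)
  from integrable_bounded_linear[OF bounded_linear_vec_nth this, of i]
  show "integrable lborel (\<lambda>x. indicator K x *\<^sub>R (g x $ i))" by simp
qed

lemma weak_gradient_unique:
  fixes u :: "real^'n \<Rightarrow> complex"
  assumes "has_weak_gradient u g" "has_weak_gradient u g'"
  shows "AE x in lborel. g x = g' x"
proof -
  have "AE x in lborel. g x $ i - g' x $ i = 0" for i
  proof (rule integral_Cc1_eq_0_imp_AE_0)
    have l: "locally_integrable (\<lambda>x. g x $ i)" "locally_integrable (\<lambda>x. g' x $ i)"
      by (rule weak_gradient_component_locally_integrable[OF assms(1)],
          rule weak_gradient_component_locally_integrable[OF assms(2)])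
    then show "locally_integrable (\<lambda>x. g x $ i - g' x $ i)"
      unfolding locally_integrable_def set_integrable_def by (auto simp: scaleR_diff_right)
    fix \<phi> :: "real^'n \<Rightarrow> complex" assume \<phi>: "\<phi> \<in> Cc1"
    have "(\<integral>x. (g x $ i - g' x $ i) * \<phi> x \<partial>lborel) = (\<integral>x. g x $ i * \<phi> x \<partial>lborel) - (\<integral>x. g' x $ i * \<phi> x \<partial>lborel)"
      unfolding left_diff_distrib
      by (intro Bochner_Integration.integral_diff locally_integrable_mult_Cc1 l \<phi>)
    also have "\<dots> = 0" using assms \<phi> by (simp add: has_weak_gradient_def)
    finally show "(\<integral>x. (g x $ i - g' x $ i) * \<phi> x \<partial>lborel) = 0" .
  qed
  then have "AE x in lborel. \<forall>i\<in>UNIV. g x $ i - g' x $ i = 0"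
    by (intro AE_finite_allI) auto
  then show ?thesis by eventually_elim (simp add: vec_eq_iff)
qed

lemma has_weak_gradient_weak_gradient:
  "has_weak_gradient u g \<Longrightarrow> has_weak_gradient u (weak_gradient u)"
  unfolding weak_gradient_def by (rule someI[of "has_weak_gradient u"])

lemma weak_gradient_eq_AE:
  assumes "has_weak_gradient u g" shows "AE x in lborel. weak_gradient u x = g x"
  using weak_gradient_unique[OF has_weak_gradient_weak_gradient[OF assms] assms] .

section \<open>The operator $L$ and its form\<close>

lemma Cc1_cnj_has_derivative:
  assumes "\<phi> \<in> Cc1"
  shows "((\<lambda>x. cnj (\<phi> x)) has_derivative (\<lambda>h. cnj (frechet_derivative \<phi> (at x) h))) (at x)"
  by (intro bounded_linear.has_derivative[OF bounded_linear_cnj] Cc1_has_derivative assms)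

lemma Cc1_cnj:
  fixes \<phi> :: "real^'n \<Rightarrow> complex"
  assumes "\<phi> \<in> Cc1" shows "(\<lambda>x. cnj (\<phi> x)) \<in> Cc1"
proof -
  obtain R where R: "0 < R" "\<And>x. x \<notin> cball 0 R \<Longrightarrow> \<phi> x = 0"
    "\<And>x i. x \<notin> cball 0 R \<Longrightarrow> partial_deriv i \<phi> x = 0"
    by (rule Cc1_support[OF assms]) (rule that)
  show ?thesis
  proof (rule Cc1I[OF Cc1_cnj_has_derivative[OF assms], where K="cball 0 R"])
    show "continuous_on UNIV (\<lambda>x. cnj (frechet_derivative \<phi> (at x) (axis i 1)))" for i
      using Cc1_continuous_partial[OF assms, of i]
      unfolding partial_deriv_def[abs_def] by (rule continuous_on_cnj)
  qed (use R in auto)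
qed

lemma partial_deriv_cnj:
  assumes "\<phi> \<in> Cc1" shows "partial_deriv i (\<lambda>x. cnj (\<phi> x)) x = cnj (partial_deriv i \<phi> x)"
  using partial_deriv_eq[OF Cc1_cnj_has_derivative[OF assms]] by (simp add: partial_deriv_def)

lemma cdot_self: "cdot z z = of_real (\<Sum>i\<in>UNIV. (norm (z $ i))\<^sup>2)"
  unfolding cdot_def of_real_sum by (simp add: complex_norm_square mult.commute flip: of_real_power)

lemma cnj_cdot: "cnj (cdot z w) = cdot w z"
  by (simp add: cdot_def mult.commute)

lemma Re_dirichlet_form_self_nonneg: "0 \<le> Re (dirichlet_form u u)"
  unfolding dirichlet_form_def cdot_self integral_complex_of_real Re_complex_of_real
  by (intro Bochner_Integration.integral_nonneg sum_nonneg) auto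

lemma cnj_dirichlet_form: "cnj (dirichlet_form u v) = dirichlet_form v u"
  unfolding dirichlet_form_def Bochner_Integration.integral_cnj[symmetric] cnj_cdot ..

context
  fixes m :: "real^'n \<Rightarrow> real" and \<alpha> :: real
  assumes m_cont: "continuous_on UNIV m" and m_pos: "\<And>x. 0 < m x" and \<alpha>_pos: "0 < \<alpha>"
begin

lemma diff_coeff_pos: "0 < diff_coeff m \<alpha> x"
  using m_pos by (simp add: diff_coeff_def add_pos_nonneg)

lemma continuous_on_diff_coeff: "continuous_on UNIV (diff_coeff m \<alpha>)"
  unfolding diff_coeff_def[abs_def]
  using \<alpha>_pos by (intro continuous_on_mult m_cont continuous_on_add continuous_on_powr' continuous_intros) auto

lemma diff_coeff_measurable [measurable]: "diff_coeff m \<alpha> \<in> borel_measurable borel"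
  by (rule borel_measurable_continuous_onI[OF continuous_on_diff_coeff])

lemma sets_weighted_measure [simp]: "sets (weighted_measure m \<alpha>) = sets borel"
  by (simp add: weighted_measure_def)

lemma measurable_weighted_measure [simp]:
  "borel_measurable (weighted_measure m \<alpha>) = borel_measurable borel"
  by (intro measurable_cong_sets) auto

lemma integrable_weighted_measure:
  fixes f :: "real^'n \<Rightarrow> 'b::{banach, second_countable_topology}"
  assumes "f \<in> borel_measurable borel"
  shows "integrable (weighted_measure m \<alpha>) f \<longleftrightarrow> integrable lborel (\<lambda>x. inverse (diff_coeff m \<alpha> x) *\<^sub>R f x)"
  unfolding weighted_measure_def using assms diff_coeff_pos
  by (intro integrable_density) (auto intro: less_imp_le)

lemma integral_weighted_measure:
  fixes f :: "real^'n \<Rightarrow> 'b::{banach, second_countable_topology}"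
  assumes "f \<in> borel_measurable borel"
  shows "(\<integral>x. f x \<partial>weighted_measure m \<alpha>) = (\<integral>x. inverse (diff_coeff m \<alpha> x) *\<^sub>R f x \<partial>lborel)"
  unfolding weighted_measure_def using assms diff_coeff_pos
  by (intro integral_density) (auto intro: less_imp_le)

lemma AE_weighted_measure: "AE x in lborel. P x \<Longrightarrow> AE x in weighted_measure m \<alpha>. P x"
  unfolding weighted_measure_def by (subst AE_density) auto

lemma continuous_compact_support_integrable:
  fixes f :: "real^'n \<Rightarrow> 'b::{banach, second_countable_topology}"
  assumes "continuous_on UNIV f" "compact K" "\<And>x. x \<notin> K \<Longrightarrow> f x = 0"
  shows "integrable lborel f"
proof -
  have "integrable lborel (\<lambda>x. indicator K x *\<^sub>R f x)"
    using assms(1) by (intro borel_integrable_compact assms(2) continuous_on_subset[OF assms(1)]) auto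
  moreover have "(\<lambda>x. indicator K x *\<^sub>R f x) = f" using assms(3) by (auto simp: indicator_def)
  ultimately show ?thesis by simp
qed

lemma continuous_compact_support_L2:
  fixes f :: "real^'n \<Rightarrow> complex"
  assumes "continuous_on UNIV f" "compact K" "\<And>x. x \<notin> K \<Longrightarrow> f x = 0"
  shows "f \<in> L2 (weighted_measure m \<alpha>)"
proof -
  have "integrable lborel (\<lambda>x. inverse (diff_coeff m \<alpha> x) *\<^sub>R (norm (f x))\<^sup>2)"
    using diff_coeff_pos assms
    by (intro continuous_compact_support_integrable[where K=K] continuous_intros continuous_on_diff_coeff)
      (auto simp: less_imp_neq[symmetric] simp del: real_scaleR_def)
  then show ?thesis
    using borel_measurable_continuous_onI[OF assms(1)]
    by (simp add: L2_def integrable_weighted_measure)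
qed

text \<open>The approximating sequence is constant. That the difference, zero, has norm zero uses that its
  chosen weak gradient vanishes almost everywhere.\<close>

lemma Cc1_subset_V_space: "Cc1 \<subseteq> V_space m \<alpha>"
proof
  fix \<phi> :: "real^'n \<Rightarrow> complex" assume \<phi>: "\<phi> \<in> Cc1"
  obtain R where R: "0 < R" "\<And>x. x \<notin> cball 0 R \<Longrightarrow> \<phi> x = 0"
    "\<And>x i. x \<notin> cball 0 R \<Longrightarrow> partial_deriv i \<phi> x = 0"
    by (rule Cc1_support[OF \<phi>]) (rule that)
  let ?g = "\<lambda>x. \<chi> i. partial_deriv i \<phi> x"
  have g_cont: "continuous_on UNIV ?g"
    by (intro continuous_on_vec_lambda Cc1_continuous_partial \<phi>)
  have g0: "?g x = 0" if "x \<notin> cball 0 R" for x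
    using R(3)[OF that] by (simp add: vec_eq_iff)
  have "integrable lborel (\<lambda>x. (norm (?g x))\<^sup>2)"
    by (intro continuous_compact_support_integrable[where K="cball 0 R"] continuous_on_power
        continuous_on_norm g_cont compact_cball) (simp add: g0)
  then have "?g \<in> L2 lborel"
    using borel_measurable_continuous_onI[OF g_cont] by (simp add: L2_def)
  moreover have "\<phi> \<in> L2 (weighted_measure m \<alpha>)"
    using R by (intro continuous_compact_support_L2[where K="cball 0 R"] Cc1_continuous \<phi>) auto
  ultimately have "\<phi> \<in> H_space m \<alpha>"
    using Cc1_has_weak_gradient[OF \<phi>] by (auto simp: H_space_def)
  moreover have "H_norm m \<alpha> (\<lambda>x. \<phi> x - \<phi> x) = 0"
  proof -
    have "has_weak_gradient (\<lambda>_::real^'n. 0) (\<lambda>_. 0)"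
      by (simp add: has_weak_gradient_def locally_integrable_def set_integrable_def)
    from weak_gradient_eq_AE[OF this]
    have "AE x in lborel. cdot (weak_gradient (\<lambda>_::real^'n. 0) x) (weak_gradient (\<lambda>_. 0) x) = 0"
      by eventually_elim (simp add: cdot_def)
    then show ?thesis by (simp add: H_norm_def H_inner_def integral_eq_zero_AE)
  qed
  ultimately show "\<phi> \<in> V_space m \<alpha>" unfolding V_space_def
    by (intro CollectI conjI allI impI bexI[OF _ \<phi>]) simp_all
qed

text \<open>For \<open>v\<close> in the form domain, the definition of its weak gradient with the partial derivatives of
  \<open>u\<close> as test functions is Green's formula. The weak gradient of \<open>u\<close> that enters the form is the
  classical one up to a null set.\<close>

lemma L_graph_Cc2:
  fixes u :: "real^'n \<Rightarrow> complex"
  assumes u: "u \<in> Cc1" and \<psi>: "\<And>i. partial_deriv i u \<in> Cc1"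
  defines "f \<equiv> \<lambda>x. of_real (diff_coeff m \<alpha> x) * (\<Sum>i\<in>UNIV. partial_deriv i (partial_deriv i u) x)"
  shows "L_graph m \<alpha> u f"
  unfolding L_graph_def
proof (intro conjI ballI)
  show "u \<in> V_space m \<alpha>" using u Cc1_subset_V_space by auto
  let ?\<psi> = "\<lambda>i. partial_deriv i u" and ?\<Delta> = "\<lambda>x. \<Sum>i\<in>UNIV. partial_deriv i (partial_deriv i u) x"
  obtain R where R: "0 < R" "\<And>x. x \<notin> cball 0 R \<Longrightarrow> u x = 0"
    "\<And>x i. x \<notin> cball 0 R \<Longrightarrow> partial_deriv i u x = 0"
    by (rule Cc1_support[OF u]) (rule that)
  have \<Delta>0: "partial_deriv i (?\<psi> i) x = 0" if "x \<notin> cball 0 R" for x i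
  proof -
    have "(?\<psi> i has_derivative (\<lambda>_. 0)) (at x)"
    proof (rule has_derivative_transform_within_open)
      show "((\<lambda>_. 0) has_derivative (\<lambda>_. 0)) (at x)" by simp
      show "open (- cball 0 R :: (real^'n) set)" by (intro open_Compl closed_cball)
    qed (use that R in auto)
    from partial_deriv_eq[OF this] show ?thesis .
  qed
  have f_cont: "continuous_on UNIV f"
    unfolding f_def by (intro continuous_intros continuous_on_diff_coeff Cc1_continuous_partial \<psi>)
  show "f \<in> L2 (weighted_measure m \<alpha>)"
    using f_cont by (rule continuous_compact_support_L2[where K="cball 0 R"]) (auto simp: f_def \<Delta>0)
  fix v assume v: "v \<in> V_space m \<alpha>"
  define g where "g = weak_gradient v"
  from v have vg: "has_weak_gradient v g"
    using has_weak_gradient_weak_gradient by (auto simp: V_space_def H_space_def g_def)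
  have g_loc: "locally_integrable (\<lambda>x. g x $ i)" for i
    by (rule weak_gradient_component_locally_integrable[OF vg])
  have v_loc: "locally_integrable v" using vg by (simp add: has_weak_gradient_def)
  have ug: "AE x in lborel. weak_gradient u x = (\<chi> i. ?\<psi> i x)"
    by (rule weak_gradient_eq_AE[OF Cc1_has_weak_gradient[OF u]])
  have wg_loc: "locally_integrable (\<lambda>x. weak_gradient u x $ i)" for i
    by (rule weak_gradient_component_locally_integrable
      [OF has_weak_gradient_weak_gradient[OF Cc1_has_weak_gradient[OF u]]])
  note [measurable] = locally_integrable_measurable[OF g_loc] locally_integrable_measurable[OF wg_loc]
    locally_integrable_measurable[OF v_loc]
    borel_measurable_continuous_onI[OF Cc1_continuous[OF \<psi>]] borel_measurable_continuous_onI[OF f_cont]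
  have int\<psi>: "integrable lborel (\<lambda>x. ?\<psi> i x * cnj (g x $ i))" for i
  proof -
    have "integrable lborel (\<lambda>x. cnj (g x $ i * cnj (?\<psi> i x)))"
      by (intro integrable_cnj locally_integrable_mult_Cc1 g_loc Cc1_cnj \<psi>)
    then show ?thesis by (simp add: mult.commute)
  qed
  have int\<Delta>: "integrable lborel (\<lambda>x. partial_deriv i (?\<psi> i) x * cnj (v x))" for i
  proof -
    have "integrable lborel (\<lambda>x. cnj (v x * partial_deriv i (\<lambda>x. cnj (?\<psi> i x)) x))"
      by (intro integrable_cnj locally_integrable_mult_Cc1 v_loc Cc1_cnj \<psi>)
    then show ?thesis by (simp add: mult.commute partial_deriv_cnj[OF \<psi>])
  qed
  have parts: "(\<integral>x. ?\<psi> i x * cnj (g x $ i) \<partial>lborel) = - (\<integral>x. partial_deriv i (?\<psi> i) x * cnj (v x) \<partial>lborel)" for i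
  proof -
    have "(\<integral>x. v x * cnj (partial_deriv i (?\<psi> i) x) \<partial>lborel) = - (\<integral>x. g x $ i * cnj (?\<psi> i x) \<partial>lborel)"
    proof -
      from vg have "\<forall>\<phi>\<in>Cc1. \<forall>i. (\<integral>x. v x * partial_deriv i \<phi> x \<partial>lborel) = - (\<integral>x. g x $ i * \<phi> x \<partial>lborel)"
        by (simp add: has_weak_gradient_def)
      from this[rule_format, OF Cc1_cnj[OF \<psi>[of i]], of i] show ?thesis
        by (simp only: partial_deriv_cnj[OF \<psi>])
    qed
    from arg_cong[OF this, of cnj] show ?thesis
      unfolding complex_cnj_minus Bochner_Integration.integral_cnj[symmetric] by (simp add: mult.commute)
  qed
  have "dirichlet_form u v = (\<integral>x. (\<Sum>i\<in>UNIV. ?\<psi> i x * cnj (g x $ i)) \<partial>lborel)"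
    unfolding dirichlet_form_def g_def[symmetric] cdot_def
  proof (rule integral_cong_AE)
    show "AE x in lborel. (\<Sum>i\<in>UNIV. weak_gradient u x $ i * cnj (g x $ i)) = (\<Sum>i\<in>UNIV. ?\<psi> i x * cnj (g x $ i))"
      using ug by eventually_elim simp
  qed measurable
  also have "\<dots> = (\<Sum>i\<in>UNIV. - (\<integral>x. partial_deriv i (?\<psi> i) x * cnj (v x) \<partial>lborel))"
    unfolding parts[symmetric] using int\<psi> by (intro Bochner_Integration.integral_sum) auto
  also have "\<dots> = - (\<integral>x. (\<Sum>i\<in>UNIV. partial_deriv i (?\<psi> i) x * cnj (v x)) \<partial>lborel)"
    unfolding sum_negf using int\<Delta> by (subst Bochner_Integration.integral_sum) auto
  also have "(\<integral>x. (\<Sum>i\<in>UNIV. partial_deriv i (?\<psi> i) x * cnj (v x)) \<partial>lborel)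
      = (\<integral>x. inverse (diff_coeff m \<alpha> x) *\<^sub>R (f x * cnj (v x)) \<partial>lborel)"
    using diff_coeff_pos[THEN less_imp_neq]
    by (intro Bochner_Integration.integral_cong)
      (auto simp: f_def scaleR_conv_of_real sum_distrib_right mult.assoc[symmetric] simp flip: of_real_mult)
  also have "\<dots> = (\<integral>x. f x * cnj (v x) \<partial>weighted_measure m \<alpha>)"
    by (rule integral_weighted_measure[symmetric]) measurable
  finally show "dirichlet_form u v = - (\<integral>x. f x * cnj (v x) \<partial>weighted_measure m \<alpha>)" .
qed

lemma L_graph_L2:
  assumes "L_graph m \<alpha> u f"
  shows "u \<in> L2 (weighted_measure m \<alpha>)" "f \<in> L2 (weighted_measure m \<alpha>)"
  using assms by (auto simp: L_graph_def V_space_def H_space_def)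

lemma L_graph_dissipative:
  assumes "L_graph m \<alpha> u f"
  shows "L2_inner (weighted_measure m \<alpha>) f u \<le> 0"
proof -
  have "dirichlet_form u u = - (\<integral>x. f x * cnj (u x) \<partial>weighted_measure m \<alpha>)"
    using assms by (simp add: L_graph_def)
  then have "Re (\<integral>x. f x * cnj (u x) \<partial>weighted_measure m \<alpha>) \<le> 0"
    using Re_dirichlet_form_self_nonneg[of u] by simp
  then show ?thesis
    using L2_inner_eq_Re_integral L_graph_L2[OF assms] by metis
qed

lemma L_graph_symmetric:
  assumes uf: "L_graph m \<alpha> u f" and vg: "L_graph m \<alpha> v g"
  shows "L2_inner (weighted_measure m \<alpha>) g u = L2_inner (weighted_measure m \<alpha>) v f"
proof -
  let ?I = "\<lambda>f g. \<integral>x. f x * cnj (g x) \<partial>weighted_measure m \<alpha>"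
  have "?I g u = - dirichlet_form v u" "?I f v = - dirichlet_form u v"
    using assms by (auto simp: L_graph_def)
  then have "?I g u = cnj (?I f v)" by (simp add: cnj_dirichlet_form)
  also have "\<dots> = ?I v f" unfolding Bochner_Integration.integral_cnj[symmetric] by (simp add: mult.commute)
  finally show ?thesis
    using L2_inner_eq_Re_integral L_graph_L2[OF uf] L_graph_L2[OF vg] by metis
qed

end

section \<open>Integrability and scaling\<close>

text \<open>On the dyadic shell $2^k \le 1 + |x| < 2^{k+1}$ the function is at most $2^{-ks}$, while the volume
  of the shell is at most a constant times $2^{kN}$, where $N < s$ is the dimension.\<close>

lemma integrable_one_plus_norm_powr:
  assumes s: "real DIM('a::euclidean_space) < s"
  shows "integrable lborel (\<lambda>x::'a. (1 + norm x) powr (- s))"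
proof (rule integrableI_bounded)
  have cont: "continuous_on UNIV (\<lambda>x::'a. (1 + norm x) powr (- s))"
    by (intro continuous_intros) (auto simp: add_nonneg_eq_0_iff)
  then show "(\<lambda>x::'a. (1 + norm x) powr (- s)) \<in> borel_measurable lborel"
    by (simp add: borel_measurable_continuous_onI)
  define N where "N = DIM('a)"
  define V where "V = unit_ball_vol (real N)"
  have V: "0 \<le> V" by (simp add: V_def)
  define q where "q = 2 powr (real N - s)"
  have q: "0 < q" "q < 1" using s by (auto simp: q_def N_def powr_less_one)
  let ?w = "\<lambda>k x::'a. ennreal (2 powr (- s * real k)) * indicator (ball 0 (2 ^ Suc k)) x"
  have "(\<integral>\<^sup>+x. ennreal (norm ((1 + norm x) powr (- s))) \<partial>(lborel :: 'a measure)) \<le> (\<integral>\<^sup>+x. (\<Sum>k. ?w k x) \<partial>lborel)"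
  proof (rule nn_integral_mono)
    fix x :: 'a
    obtain n0 where "1 + norm x < 2 ^ n0" using real_arch_pow[of 2 "1 + norm x"] by auto
    then have ex: "\<exists>n. 1 + norm x < 2 ^ n" by blast
    define n where "n = (LEAST n. 1 + norm x < 2 ^ n)"
    have n: "1 + norm x < 2 ^ n" unfolding n_def using ex by (rule LeastI_ex)
    then have "n \<noteq> 0" by (intro notI) simp
    then obtain k where k: "n = Suc k" by (cases n) auto
    have "\<not> 1 + norm x < 2 ^ k" using not_less_Least[of k "\<lambda>n. 1 + norm x < 2 ^ n"] k by (simp add: n_def)
    then have "(2::real) powr real k \<le> 1 + norm x" by (simp add: powr_realpow)
    then have "(1 + norm x) powr (- s) \<le> (2 powr real k) powr (- s)"
      using s by (intro powr_mono2') auto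
    also have "\<dots> = 2 powr (- s * real k)" by (simp add: powr_powr mult.commute)
    finally have "ennreal (norm ((1 + norm x) powr (- s))) \<le> ?w k x"
      using n k by (auto simp: indicator_def intro!: ennreal_leI)
    also have "\<dots> \<le> (\<Sum>k. ?w k x)"
    proof -
      have "g k \<le> (\<Sum>k. g k)" for g :: "nat \<Rightarrow> ennreal"
        using sum_le_suminf[of g "{k}"] by simp
      then show ?thesis .
    qed
    finally show "ennreal (norm ((1 + norm x) powr (- s))) \<le> (\<Sum>k. ?w k x)" .
  qed
  also have "\<dots> = (\<Sum>k. \<integral>\<^sup>+x. ?w k x \<partial>lborel)"
    by (rule nn_integral_suminf, intro borel_measurable_times_ennreal borel_measurable_const borel_measurable_indicator) simp
  also have "\<dots> = (\<Sum>k. ennreal (2 ^ N * V * q ^ k))"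
  proof (rule suminf_cong)
    fix k
    have "(\<integral>\<^sup>+x. ?w k x \<partial>lborel) = ennreal (2 powr (- s * real k)) * ennreal (V * (2 ^ Suc k) ^ N)"
      by (subst nn_integral_cmult_indicator) (auto simp: emeasure_ball V_def N_def)
    also have "\<dots> = ennreal (2 powr (- s * real k) * (V * (2 ^ Suc k) ^ N))"
      using V by (intro ennreal_mult[symmetric]) auto
    also have "2 powr (- s * real k) * (V * (2 ^ Suc k) ^ N) = 2 ^ N * V * q ^ k"
    proof -
      have "q ^ k = 2 powr (real N * real k) * 2 powr (- s * real k)"
        using q by (simp add: q_def powr_realpow[symmetric] powr_powr powr_add[symmetric] algebra_simps)
      moreover have "2 powr (real N * real k) = (2 ^ k) ^ N"
        by (simp add: powr_realpow[symmetric] powr_powr mult.commute)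
      ultimately show ?thesis by (simp add: power_mult_distrib)
    qed
    finally show "(\<integral>\<^sup>+x. ?w k x \<partial>lborel) = ennreal (2 ^ N * V * q ^ k)" .
  qed
  also have "\<dots> < \<infinity>"
  proof -
    have "summable (\<lambda>k. 2 ^ N * V * q ^ k)" using q by (intro summable_mult summable_geometric) auto
    then show ?thesis using V q by (subst suminf_ennreal2) auto
  qed
  finally show "(\<integral>\<^sup>+x. ennreal (norm ((1 + norm x) powr (- s))) \<partial>(lborel :: 'a measure)) < \<infinity>" .
qed

lemma L2_norm_mono_AE:
  assumes "f \<in> borel_measurable M" "g \<in> L2 M" "AE x in M. norm (f x) \<le> norm (g x)"
  shows "L2_norm M f \<le> L2_norm M g"
  unfolding L2_norm_def
proof (rule real_sqrt_le_mono, rule integral_mono_AE)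
  show g: "integrable M (\<lambda>x. (norm (g x))\<^sup>2)" using assms by (simp add: L2_def)
  have sq: "AE x in M. (norm (f x))\<^sup>2 \<le> (norm (g x))\<^sup>2"
    using assms(3) by eventually_elim (rule power_mono, auto)
  then show "integrable M (\<lambda>x. (norm (f x))\<^sup>2)"
    using assms(1) by (intro Bochner_Integration.integrable_bound[OF g]) auto
  show "AE x in M. (norm (f x))\<^sup>2 \<le> (norm (g x))\<^sup>2" by (rule sq)
qed

text \<open>The two terms on the right balance the left-hand side at different times. The choice
  \<open>t = \<epsilon> * r powr (2 - \<alpha>)\<close> makes the first one at most half of the left-hand side, and the second one then
  bounds a positive power of \<open>r\<close> if the claim fails.\<close>

lemma scaling_exponent:
  fixes N \<alpha> \<beta> k K D :: real
  assumes pos: "0 < k" "0 < K" "0 \<le> D" and \<alpha>: "2 < \<alpha>"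
    and ineq: "\<And>r t. \<lbrakk>1 \<le> r; 0 < t; t \<le> 1\<rbrakk> \<Longrightarrow>
      k * r powr (N - \<alpha>) \<le> t * (K * r powr (N - 2)) + D / t powr \<beta> * r powr (4 - 2 * \<alpha>)"
  shows "(N + \<alpha> - 4) / (\<alpha> - 2) \<le> \<beta>"
proof (rule ccontr)
  assume "\<not> ?thesis"
  then have \<gamma>: "0 < N + \<alpha> - 4 - \<beta> * (\<alpha> - 2)" using \<alpha> by (simp add: field_simps)
  define \<gamma> where "\<gamma> = N + \<alpha> - 4 - \<beta> * (\<alpha> - 2)"
  define \<epsilon> where "\<epsilon> = min 1 (k / (2 * K))"
  have \<epsilon>: "0 < \<epsilon>" "\<epsilon> \<le> 1" "\<epsilon> * K \<le> k / 2" using pos by (auto simp: \<epsilon>_def min_def field_simps)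
  have bound: "r powr \<gamma> \<le> 2 * D / (k * \<epsilon> powr \<beta>)" if r: "1 \<le> r" for r
  proof -
    define t where "t = \<epsilon> * r powr (2 - \<alpha>)"
    have "r powr (2 - \<alpha>) \<le> 1" using powr_mono[of "2 - \<alpha>" 0 r] r \<alpha> by simp
    then have t: "0 < t" "t \<le> 1" using \<epsilon> r by (auto simp: t_def intro: mult_le_one)
    have "t * (K * r powr (N - 2)) = \<epsilon> * K * r powr (N - \<alpha>)"
      using r by (simp add: t_def powr_add[symmetric])
    also have "\<dots> \<le> k / 2 * r powr (N - \<alpha>)" using \<epsilon> by (intro mult_right_mono) auto
    finally have "k / 2 * r powr (N - \<alpha>) \<le> D / t powr \<beta> * r powr (4 - 2 * \<alpha>)"
      using ineq[OF r t] by linarith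
    also have "t powr \<beta> = \<epsilon> powr \<beta> * r powr (\<beta> * (2 - \<alpha>))"
      using \<epsilon> r by (simp add: t_def powr_mult powr_powr mult.commute)
    also have "D / (\<epsilon> powr \<beta> * r powr (\<beta> * (2 - \<alpha>))) * r powr (4 - 2 * \<alpha>)
        = D / \<epsilon> powr \<beta> * r powr (4 - 2 * \<alpha> - \<beta> * (2 - \<alpha>))"
      using r by (simp add: powr_diff)
    finally have "k / 2 * r powr (N - \<alpha>) \<le> D / \<epsilon> powr \<beta> * r powr (4 - 2 * \<alpha> - \<beta> * (2 - \<alpha>))" .
    moreover have "r powr (N - \<alpha>) = r powr \<gamma> * r powr (4 - 2 * \<alpha> - \<beta> * (2 - \<alpha>))"
      using r by (simp add: \<gamma>_def powr_add[symmetric] algebra_simps)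
    ultimately have "(k / 2 * r powr \<gamma>) * r powr (4 - 2 * \<alpha> - \<beta> * (2 - \<alpha>))
        \<le> (D / \<epsilon> powr \<beta>) * r powr (4 - 2 * \<alpha> - \<beta> * (2 - \<alpha>))"
      by (simp only: mult.assoc)
    then have "k / 2 * r powr \<gamma> \<le> D / \<epsilon> powr \<beta>" using r by (subst (asm) mult_le_cancel_right) auto
    then show ?thesis using pos \<epsilon> by (simp add: field_simps)
  qed
  define B where "B = \<bar>2 * D / (k * \<epsilon> powr \<beta>)\<bar>"
  have "1 \<le> (B + 1) powr (1 / \<gamma>)" using \<gamma> by (intro ge_one_powr_ge_zero) (auto simp: B_def \<gamma>_def)
  from bound[OF this] have "B + 1 \<le> 2 * D / (k * \<epsilon> powr \<beta>)"
    using \<gamma> by (simp add: powr_powr B_def \<gamma>_def)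
  also have "\<dots> \<le> B" unfolding B_def by (rule abs_ge_self)
  finally show False by simp
qed

text \<open>The spatial factor of the kernel bound.\<close>

definition decay :: "real^'n \<Rightarrow> real" where "decay x = (1 + norm x) powr (2 - real CARD('n))"

section \<open>Consequences of the kernel bound and test functions\<close>

context
  fixes m :: "real^'n \<Rightarrow> real" and \<alpha> m0 M1 :: real
  assumes m_cont: "continuous_on UNIV m" and m0: "0 < m0" "\<And>x. m0 \<le> m x" and M1: "\<And>x. m x \<le> M1"
    and \<alpha>: "2 < \<alpha>" and N3: "3 \<le> CARD('n)"
begin

abbreviation "\<mu> \<equiv> weighted_measure m \<alpha>"
lemma m_pos: "0 < m x" using m0(1) m0(2)[of x] by linarith

lemma \<alpha>_pos: "0 < \<alpha>" using \<alpha> by simp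

lemmas coeff_pos = diff_coeff_pos[OF m_cont m_pos \<alpha>_pos]
lemmas integral_\<mu> = integral_weighted_measure[OF m_cont m_pos \<alpha>_pos]
lemmas integrable_\<mu> = integrable_weighted_measure[OF m_cont m_pos \<alpha>_pos]
lemmas measurable_\<mu> [simp] = measurable_weighted_measure[OF m_cont m_pos \<alpha>_pos]
lemmas [measurable] = diff_coeff_measurable[OF m_cont m_pos \<alpha>_pos]

lemma decay_pos: "0 < decay x"
proof -
  have "0 < 1 + norm x" by (simp add: add_pos_nonneg)
  then show ?thesis by (simp add: decay_def)
qed

lemma decay_measurable [measurable]: "decay \<in> borel_measurable borel"
  unfolding decay_def[abs_def]
  by (intro borel_measurable_continuous_onI continuous_intros) (auto simp: add_nonneg_eq_0_iff)

lemma coeff_ge: "m0 / 2 powr \<alpha> * (1 + norm x) powr \<alpha> \<le> diff_coeff m \<alpha> x"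
proof -
  have "(1 + norm x) powr \<alpha> \<le> (2 * max 1 (norm x)) powr \<alpha>"
    using \<alpha> by (intro powr_mono2) auto
  also have "\<dots> = 2 powr \<alpha> * max 1 (norm x) powr \<alpha>" by (simp add: powr_mult)
  also have "max 1 (norm x) powr \<alpha> \<le> 1 + norm x powr \<alpha>" by (simp add: max_def)
  finally have "(1 + norm x) powr \<alpha> / 2 powr \<alpha> \<le> 1 + norm x powr \<alpha>" by (simp add: field_simps)
  then have "m0 * ((1 + norm x) powr \<alpha> / 2 powr \<alpha>) \<le> m x * (1 + norm x powr \<alpha>)"
    using m0 m_pos[of x] by (intro mult_mono) (auto intro: less_imp_le)
  then show ?thesis by (simp add: diff_coeff_def)
qed

text \<open>The integrand is of order $|x|^{4 - 2N - \alpha}$ at infinity, and $2N - 4 + \alpha > N$ because $N \ge 3$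
  and $\alpha > 2$.\<close>

lemma decay_L2: "(\<lambda>x. complex_of_real (decay x)) \<in> L2 \<mu>"
proof -
  have "integrable lborel (\<lambda>x::real^'n. inverse (diff_coeff m \<alpha> x) *\<^sub>R (decay x)\<^sup>2)"
  proof (rule Bochner_Integration.integrable_bound)
    have "real CARD('n) < 2 * real CARD('n) - 4 + \<alpha>" using N3 \<alpha> by simp
    then have "integrable lborel (\<lambda>x::real^'n. (1 + norm x) powr (- (2 * real CARD('n) - 4 + \<alpha>)))"
      by (intro integrable_one_plus_norm_powr) simp
    then show "integrable lborel (\<lambda>x::real^'n. 2 powr \<alpha> / m0 * (1 + norm x) powr (- (2 * real CARD('n) - 4 + \<alpha>)))"
      by (rule integrable_mult_right)
    show "(\<lambda>x. inverse (diff_coeff m \<alpha> x) *\<^sub>R (decay x)\<^sup>2) \<in> borel_measurable lborel" by measurable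
    show "AE x in lborel. norm (inverse (diff_coeff m \<alpha> x) *\<^sub>R (decay x)\<^sup>2)
        \<le> norm (2 powr \<alpha> / m0 * (1 + norm x) powr (- (2 * real CARD('n) - 4 + \<alpha>)))"
    proof (rule AE_I2)
      fix x :: "real^'n"
      have x: "0 < 1 + norm x" by (simp add: add_pos_nonneg)
      have sq: "(decay x)\<^sup>2 = (1 + norm x) powr (4 - 2 * real CARD('n))"
        by (simp add: decay_def power2_eq_square powr_add[symmetric])
      have "inverse (diff_coeff m \<alpha> x) \<le> inverse (m0 / 2 powr \<alpha> * (1 + norm x) powr \<alpha>)"
        using m0 x by (intro le_imp_inverse_le coeff_ge) auto
      then have "inverse (diff_coeff m \<alpha> x) * (decay x)\<^sup>2
          \<le> inverse (m0 / 2 powr \<alpha> * (1 + norm x) powr \<alpha>) * (1 + norm x) powr (4 - 2 * real CARD('n))"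
        unfolding sq by (rule mult_right_mono) simp
      also have "inverse (m0 / 2 powr \<alpha> * (1 + norm x) powr \<alpha>) * (1 + norm x) powr (4 - 2 * real CARD('n))
          = 2 powr \<alpha> / m0 * ((1 + norm x) powr (4 - 2 * real CARD('n)) / (1 + norm x) powr \<alpha>)"
        using m0 x by (simp add: field_simps)
      also have "(1 + norm x) powr (4 - 2 * real CARD('n)) / (1 + norm x) powr \<alpha> = (1 + norm x) powr (- (2 * real CARD('n) - 4 + \<alpha>))"
        by (simp add: powr_diff[symmetric] algebra_simps)
      finally show "norm (inverse (diff_coeff m \<alpha> x) *\<^sub>R (decay x)\<^sup>2)
        \<le> norm (2 powr \<alpha> / m0 * (1 + norm x) powr (- (2 * real CARD('n) - 4 + \<alpha>)))"
        using m0 coeff_pos[of x] by (simp add: less_imp_le)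
    qed
  qed
  then show ?thesis
    using decay_pos by (simp add: L2_def integrable_\<mu> less_imp_le)
qed

lemma decay_mult_integrable:
  assumes "f \<in> L2 \<mu>"
  shows "integrable \<mu> (\<lambda>x. decay x * norm (f x))"
    and "(\<integral>x. decay x * norm (f x) \<partial>\<mu>) \<le> L2_norm \<mu> (\<lambda>x. complex_of_real (decay x)) * L2_norm \<mu> f"
proof -
  have nf: "(\<lambda>x. complex_of_real (norm (f x))) \<in> L2 \<mu>" using assms by (auto simp: L2_def)
  have *: "Re (complex_of_real (decay x) * cnj (complex_of_real (norm (f x)))) = decay x * norm (f x)" for x
    by simp
  show "integrable \<mu> (\<lambda>x. decay x * norm (f x))"
    using L2_integrable_Re_mult[OF decay_L2 nf] by (simp only: *)
  have "(\<integral>x. decay x * norm (f x) \<partial>\<mu>) = L2_inner \<mu> (\<lambda>x. complex_of_real (decay x)) (\<lambda>x. complex_of_real (norm (f x)))"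
    by (simp only: L2_inner_def *)
  also have "\<dots> \<le> L2_norm \<mu> (\<lambda>x. complex_of_real (decay x)) * L2_norm \<mu> (\<lambda>x. complex_of_real (norm (f x)))"
    using L2_inner_le[OF decay_L2 nf] by simp
  also have "L2_norm \<mu> (\<lambda>x. complex_of_real (norm (f x))) = L2_norm \<mu> f" by (simp add: L2_norm_def)
  finally show "(\<integral>x. decay x * norm (f x) \<partial>\<mu>) \<le> L2_norm \<mu> (\<lambda>x. complex_of_real (decay x)) * L2_norm \<mu> f" .
qed

context
  fixes \<beta> C :: real and T p
  assumes sg: "semigroup_generated_by_L m \<alpha> T" and ker: "kernel_of m \<alpha> T p"
    and \<beta>: "0 < \<beta>" and C: "0 < C"
    and bound: "\<And>t x y. \<lbrakk>0 < t; t \<le> 1\<rbrakk> \<Longrightarrow> p_mu m \<alpha> p x y t \<le> C / t powr \<beta> * decay x * decay y"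
begin

lemma semigroup_pointwise_bound:
  assumes t: "0 < t" "t \<le> 1" and f: "f \<in> L2 \<mu>"
  shows "AE x in lborel. norm (T t f x) \<le> C / t powr \<beta> * decay x * (\<integral>y. decay y * norm (f y) \<partial>\<mu>)"
proof -
  have "AE x in lborel. integrable lborel (\<lambda>y. of_real (p x y t) * f y) \<and>
           T t f x = (\<integral>y. of_real (p x y t) * f y \<partial>lborel)"
    using ker t f by (simp add: kernel_of_def)
  then show ?thesis
  proof eventually_elim
    case (elim x)
    define A where "A = C / t powr \<beta> * decay x"
    have A: "0 \<le> A" using C decay_pos[of x] by (simp add: A_def)
    have f_meas: "f \<in> borel_measurable borel" using L2_measurable[OF f] by simp
    have int: "integrable lborel (\<lambda>y. A * (inverse (diff_coeff m \<alpha> y) *\<^sub>R (decay y * norm (f y))))"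
      using decay_mult_integrable(1)[OF f] f_meas
      by (intro integrable_mult_right) (simp add: integrable_\<mu>)
    have "norm (T t f x) = norm (\<integral>y. of_real (p x y t) * f y \<partial>lborel)" using elim by simp
    also have "\<dots> \<le> (\<integral>y. norm (of_real (p x y t) * f y) \<partial>lborel)" by (rule integral_norm_bound)
    also have "\<dots> \<le> (\<integral>y. A * (inverse (diff_coeff m \<alpha> y) *\<^sub>R (decay y * norm (f y))) \<partial>lborel)"
    proof (rule integral_mono)
      show "integrable lborel (\<lambda>y. norm (of_real (p x y t) * f y))" using elim by auto
      fix y
      have p0: "0 < p x y t" using ker t by (simp add: kernel_of_def)
      have "diff_coeff m \<alpha> y * p x y t \<le> A * decay y"
        using bound[OF t, of x y] by (simp add: A_def p_mu_def diff_coeff_def)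
      then have "p x y t \<le> A * (inverse (diff_coeff m \<alpha> y) * decay y)"
        using coeff_pos[of y] by (simp add: field_simps)
      then have "p x y t * norm (f y) \<le> A * (inverse (diff_coeff m \<alpha> y) * decay y) * norm (f y)"
        by (rule mult_right_mono) simp
      then show "norm (of_real (p x y t) * f y) \<le> A * (inverse (diff_coeff m \<alpha> y) *\<^sub>R (decay y * norm (f y)))"
        using p0 by (simp add: norm_mult mult.assoc)
    qed (rule int)
    also have "\<dots> = A * (\<integral>y. decay y * norm (f y) \<partial>\<mu>)"
      using f_meas by (simp add: integral_\<mu>)
    finally show ?case by (simp add: A_def)
  qed
qed

lemma C0: "C0_semigroup \<mu> T"
  using sg by (simp add: semigroup_generated_by_L_def)

lemma generator_eq_L: "generator_graph \<mu> T u f \<longleftrightarrow> L_graph m \<alpha> u f"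
  using sg by (simp add: semigroup_generated_by_L_def)

text \<open>The kernel is dominated by the rank one kernel $C t^{-\beta} \phi(x) \phi(y)$ with
  $\phi \in L^2_\mu$, whose operator norm is at most $C \delta^{-\beta} \|\phi\|^2$ for $t \ge \delta$.\<close>

lemma semigroup_locally_bounded:
  assumes "0 < \<delta>"
  shows "\<exists>K. \<forall>t f. \<delta> \<le> t \<and> t \<le> 1 \<and> f \<in> L2 \<mu> \<longrightarrow> L2_norm \<mu> (T t f) \<le> K * L2_norm \<mu> f"
proof -
  let ?\<phi> = "\<lambda>x. complex_of_real (decay x)"
  have "L2_norm \<mu> (T t f) \<le> (C / \<delta> powr \<beta> * (L2_norm \<mu> ?\<phi>)\<^sup>2) * L2_norm \<mu> f"
    if t: "\<delta> \<le> t" "t \<le> 1" and f: "f \<in> L2 \<mu>" for t f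
  proof -
    have t0: "0 < t" using t assms by simp
    define A where "A = C / \<delta> powr \<beta> * (L2_norm \<mu> ?\<phi> * L2_norm \<mu> f)"
    have A: "0 \<le> A" using C by (simp add: A_def)
    have le: "C / t powr \<beta> * decay x * (\<integral>y. decay y * norm (f y) \<partial>\<mu>) \<le> A * decay x" for x
    proof -
      have "C / t powr \<beta> * (\<integral>y. decay y * norm (f y) \<partial>\<mu>) \<le> A"
        unfolding A_def
      proof (rule mult_mono)
        show "C / t powr \<beta> \<le> C / \<delta> powr \<beta>"
          using t t0 assms C \<beta> by (intro divide_left_mono powr_mono2) auto
        show "0 \<le> (\<integral>y. decay y * norm (f y) \<partial>\<mu>)"
          by (intro Bochner_Integration.integral_nonneg mult_nonneg_nonneg less_imp_le[OF decay_pos]) simp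
      qed (use decay_mult_integrable[OF f] C in auto)
      then have "C / t powr \<beta> * (\<integral>y. decay y * norm (f y) \<partial>\<mu>) * decay x \<le> A * decay x"
        using decay_pos[of x] by (intro mult_right_mono) auto
      then show ?thesis by (simp add: mult_ac)
    qed
    have "AE x in lborel. norm (T t f x) \<le> norm (of_real A * ?\<phi> x)"
      using semigroup_pointwise_bound[OF t0 t(2) f]
    proof eventually_elim
      case (elim x)
      then have "norm (T t f x) \<le> A * decay x" using le[of x] by linarith
      then show ?case using A decay_pos[of x] by (simp add: norm_mult)
    qed
    then have "AE x in \<mu>. norm (T t f x) \<le> norm (of_real A * ?\<phi> x)"
      by (rule AE_weighted_measure[OF m_cont m_pos \<alpha>_pos])
    then have "L2_norm \<mu> (T t f) \<le> L2_norm \<mu> (\<lambda>x. of_real A * ?\<phi> x)"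
      using t0 f by (intro L2_norm_mono_AE L2_scale decay_L2 L2_measurable semigroup_L2[OF C0]) auto
    also have "\<dots> = A * L2_norm \<mu> ?\<phi>" using A by (simp add: L2_norm_scale)
    finally show ?thesis by (simp add: A_def power2_eq_square mult_ac)
  qed
  then show ?thesis by blast
qed

text \<open>Comparison of the lower bound for $(T(t)u,u)$ given by the generator with the upper bound given by
  the kernel.\<close>

lemma weighted_Nash_inequality:
  assumes gen: "L_graph m \<alpha> u f" and t: "0 < t" "t \<le> 1"
  shows "(L2_norm \<mu> u)\<^sup>2 \<le> t * (L2_norm \<mu> u * L2_norm \<mu> f)
    + C / t powr \<beta> * (\<integral>x. decay x * norm (u x) \<partial>\<mu>)\<^sup>2"
proof -
  have u: "u \<in> L2 \<mu>" using L_graph_L2[OF m_cont m_pos \<alpha>_pos gen] by simp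
  define I where "I = (\<integral>x. decay x * norm (u x) \<partial>\<mu>)"
  have "(L2_norm \<mu> u)\<^sup>2 - t * (L2_norm \<mu> u * L2_norm \<mu> f) \<le> L2_inner \<mu> (T t u) u"
  proof (rule symmetric_orbit_lower_bound[OF C0 semigroup_locally_bounded])
    show "L2_inner \<mu> g v \<le> 0" if "generator_graph \<mu> T v g" for v g
      using that unfolding generator_eq_L by (rule L_graph_dissipative[OF m_cont m_pos \<alpha>_pos])
    show "L2_inner \<mu> g u = L2_inner \<mu> v f" if "generator_graph \<mu> T v g" for v g
      using that gen unfolding generator_eq_L by (intro L_graph_symmetric[OF m_cont m_pos \<alpha>_pos])
    show "generator_graph \<mu> T u f" using gen by (simp add: generator_eq_L)
  qed (use t in auto)
  also have "L2_inner \<mu> (T t u) u \<le> (\<integral>x. C / t powr \<beta> * I * (decay x * norm (u x)) \<partial>\<mu>)"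
    unfolding L2_inner_def
  proof (rule integral_mono_AE)
    show "integrable \<mu> (\<lambda>x. Re (T t u x * cnj (u x)))"
      using t u by (intro L2_integrable_Re_mult semigroup_L2[OF C0]) auto
    show "integrable \<mu> (\<lambda>x. C / t powr \<beta> * I * (decay x * norm (u x)))"
      by (intro integrable_mult_right decay_mult_integrable u)
    have "AE x in lborel. Re (T t u x * cnj (u x)) \<le> C / t powr \<beta> * I * (decay x * norm (u x))"
      using semigroup_pointwise_bound[OF t u]
    proof eventually_elim
      case (elim x)
      have "Re (T t u x * cnj (u x)) \<le> norm (T t u x * cnj (u x))" by (rule complex_Re_le_cmod)
      also have "\<dots> = norm (T t u x) * norm (u x)" by (simp add: norm_mult)
      also have "\<dots> \<le> C / t powr \<beta> * decay x * I * norm (u x)"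
        using elim unfolding I_def by (rule mult_right_mono) simp
      finally show ?case by (simp add: mult_ac)
    qed
    then show "AE x in \<mu>. Re (T t u x * cnj (u x)) \<le> C / t powr \<beta> * I * (decay x * norm (u x))"
      by (rule AE_weighted_measure[OF m_cont m_pos \<alpha>_pos])
  qed
  also have "\<dots> = C / t powr \<beta> * I\<^sup>2"
    by (simp add: I_def[symmetric] power2_eq_square)
  finally show ?thesis by (simp add: I_def)
qed

end

lemma integral_ball_le:
  assumes h: "h \<in> borel_measurable borel" "\<And>x. h x \<le> B * indicator (ball c r) x" "\<And>x. 0 \<le> h x"
    and B: "0 \<le> B" and k: "0 < k" "\<And>x. x \<in> ball c r \<Longrightarrow> k \<le> diff_coeff m \<alpha> x" and r: "0 \<le> r"
  shows "(\<integral>x. h x \<partial>\<mu>) \<le> B / k * (unit_ball_vol (real CARD('n)) * r ^ CARD('n))"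
proof -
  have "(\<integral>x. h x \<partial>\<mu>) = (\<integral>x. inverse (diff_coeff m \<alpha> x) *\<^sub>R h x \<partial>lborel)"
    using h by (simp add: integral_\<mu>)
  also have "\<dots> \<le> (\<integral>x. B / k * indicator (ball c r) x \<partial>lborel)"
  proof (rule integral_mono')
    show "integrable lborel (\<lambda>x. B / k * indicator (ball c r) x :: real)"
      using emeasure_lborel_ball_finite[of c r]
      by (intro integrable_mult_right integrable_real_indicator) auto
    show "0 \<le> B / k * indicator (ball c r) x" for x using B k by simp
    fix x
    show "inverse (diff_coeff m \<alpha> x) *\<^sub>R h x \<le> B / k * indicator (ball c r) x"
    proof (cases "x \<in> ball c r")
      case True
      then have "inverse (diff_coeff m \<alpha> x) * h x \<le> inverse k * B"
        using k h(2)[of x] h(3)[of x] by (intro mult_mono le_imp_inverse_le) auto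
      with True show ?thesis by (simp add: divide_inverse mult.commute)
    next
      case False
      with h(2)[of x] h(3)[of x] show ?thesis by simp
    qed
  qed
  also have "\<dots> = B / k * measure lborel (ball c r)"
    by simp
  finally show ?thesis using r by (simp add: content_ball)
qed

lemma integral_ball_ge:
  assumes h: "integrable \<mu> h" "\<And>x. B * indicator (ball c r) x \<le> h x" "\<And>x. 0 \<le> h x"
    and B: "0 \<le> B" and k: "0 < k" "\<And>x. x \<in> ball c r \<Longrightarrow> diff_coeff m \<alpha> x \<le> k" and r: "0 \<le> r"
  shows "B / k * (unit_ball_vol (real CARD('n)) * r ^ CARD('n)) \<le> (\<integral>x. h x \<partial>\<mu>)"
proof -
  have h_meas: "h \<in> borel_measurable borel" using borel_measurable_integrable[OF h(1)] by simp
  have "B / k * (unit_ball_vol (real CARD('n)) * r ^ CARD('n)) = B / k * measure lborel (ball c r)"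
    using r by (simp add: content_ball)
  also have "\<dots> = (\<integral>x. B / k * indicator (ball c r) x \<partial>lborel)" by simp
  also have "\<dots> \<le> (\<integral>x. inverse (diff_coeff m \<alpha> x) *\<^sub>R h x \<partial>lborel)"
  proof (rule integral_mono')
    show "integrable lborel (\<lambda>x. inverse (diff_coeff m \<alpha> x) *\<^sub>R h x)"
      using h(1) h_meas by (simp add: integrable_\<mu>)
    show "0 \<le> inverse (diff_coeff m \<alpha> x) *\<^sub>R h x" for x
      using h(3)[of x] coeff_pos[of x] by simp
    fix x
    show "B / k * indicator (ball c r) x \<le> inverse (diff_coeff m \<alpha> x) *\<^sub>R h x"
    proof (cases "x \<in> ball c r")
      case True
      then have "inverse k * B \<le> inverse (diff_coeff m \<alpha> x) * h x"
        using k B h(2)[of x] coeff_pos[of x] by (intro mult_mono le_imp_inverse_le) auto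
      with True show ?thesis by (simp add: divide_inverse mult.commute)
    next
      case False
      with h(3)[of x] coeff_pos[of x] show ?thesis by simp
    qed
  qed
  also have "\<dots> = (\<integral>x. h x \<partial>\<mu>)" using h_meas by (simp add: integral_\<mu>)
  finally show ?thesis .
qed

text \<open>Second derivatives of a bump of radius \<open>r\<close> are of order \<open>1 / r\<^sup>2\<close>.\<close>

lemma bump_in_domain:
  fixes c :: "real^'n"
  assumes r: "0 < r"
  obtains f where "L_graph m \<alpha> (\<lambda>x. of_real (bump 3 c r x)) f"
    "\<And>x. norm (f x) \<le> diff_coeff m \<alpha> x * (6 * (real CARD('n) + 4) / r\<^sup>2) * indicator (ball c r) x"
proof -
  let ?u = "\<lambda>x. complex_of_real (bump 3 c r x)"
  let ?\<Delta> = "\<lambda>x. \<Sum>i\<in>UNIV. partial_deriv i (partial_deriv i ?u) x"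
  have u: "?u \<in> Cc1" "\<And>i. partial_deriv i ?u \<in> Cc1"
    using bump_Cc1(1)[of 3 r c] bump_partial_Cc1(1)[of 3 r _ c] r by auto
  have \<Delta>: "norm (?\<Delta> x) \<le> 6 * (real CARD('n) + 4) / r\<^sup>2 * indicator (ball c r) x" for x
  proof -
    have eq: "?\<Delta> x = complex_of_real (- 6 / r\<^sup>2 *
        (real CARD('n) * bump 2 c r x - 4 / r\<^sup>2 * bump 1 c r x * (norm (x - c))\<^sup>2))"
      using bump_partial_Cc1(2)[of 3 r c x] r by simp
    show ?thesis
    proof (cases "x \<in> ball c r")
      case True
      have "(norm (x - c))\<^sup>2 \<le> r\<^sup>2"
        using True by (intro power_mono) (auto simp: dist_norm norm_minus_commute)
      then have q: "(norm (x - c))\<^sup>2 / r\<^sup>2 \<le> 1" using r by simp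
      have 1: "\<bar>real CARD('n) * bump 2 c r x\<bar> \<le> real CARD('n) * 1"
        unfolding abs_mult using bump_bounds[of 2 c r x] by (intro mult_mono) auto
      have 2: "\<bar>4 * (bump 1 c r x * ((norm (x - c))\<^sup>2 / r\<^sup>2))\<bar> \<le> 4 * (1 * 1)"
        unfolding abs_mult using bump_bounds[of 1 c r x] q by (intro mult_mono) auto
      have "\<bar>real CARD('n) * bump 2 c r x - 4 / r\<^sup>2 * bump 1 c r x * (norm (x - c))\<^sup>2\<bar> \<le> real CARD('n) + 4"
      proof -
        have "4 / r\<^sup>2 * bump 1 c r x * (norm (x - c))\<^sup>2 = 4 * (bump 1 c r x * ((norm (x - c))\<^sup>2 / r\<^sup>2))"
          by simp
        with 1 2 show ?thesis by linarith
      qed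
      then have "6 / r\<^sup>2 * \<bar>real CARD('n) * bump 2 c r x - 4 / r\<^sup>2 * bump 1 c r x * (norm (x - c))\<^sup>2\<bar>
          \<le> 6 / r\<^sup>2 * (real CARD('n) + 4)"
        by (intro mult_left_mono) auto
      then show ?thesis
        unfolding eq norm_of_real abs_mult using True r by (simp add: abs_mult)
    next
      case False
      then have "bump 2 c r x = 0" "bump 1 c r x = 0" using r by (auto simp: bump_eq_0_iff)
      then show ?thesis unfolding eq using False by simp
    qed
  qed
  show thesis
  proof (rule that)
    show "L_graph m \<alpha> ?u (\<lambda>x. of_real (diff_coeff m \<alpha> x) * ?\<Delta> x)"
      by (rule L_graph_Cc2[OF m_cont m_pos \<alpha>_pos u])
    fix x
    have "diff_coeff m \<alpha> x * norm (?\<Delta> x) \<le> diff_coeff m \<alpha> x * (6 * (real CARD('n) + 4) / r\<^sup>2 * indicator (ball c r) x)"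
      using coeff_pos[of x] \<Delta>[of x] by (intro mult_left_mono) auto
    then show "norm (of_real (diff_coeff m \<alpha> x) * ?\<Delta> x)
        \<le> diff_coeff m \<alpha> x * (6 * (real CARD('n) + 4) / r\<^sup>2) * indicator (ball c r) x"
      using coeff_pos[of x] by (simp only: norm_mult norm_of_real mult.assoc abs_of_pos)
  qed
qed

lemma coeff_bounds_on_ball:
  assumes r: "1 \<le> r" and c: "norm c = 2 * r" and x: "x \<in> ball c r"
  shows "m0 * r powr \<alpha> \<le> diff_coeff m \<alpha> x" "diff_coeff m \<alpha> x \<le> 2 * M1 * 4 powr \<alpha> * r powr \<alpha>"
    "decay x \<le> r powr (2 - real CARD('n))"
proof -
  have "norm (x - c) < r" using x by (simp add: dist_norm norm_minus_commute)
  then have n: "r \<le> norm x" "norm x \<le> 4 * r"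
    using norm_triangle_ineq2[of c x] norm_triangle_ineq2[of x c] c r by (auto simp: norm_minus_commute)
  have M1p: "0 < M1" using m_pos[of x] M1[of x] by linarith
  have "r powr \<alpha> \<le> norm x powr \<alpha>" using n r \<alpha> by (intro powr_mono2) auto
  then show "m0 * r powr \<alpha> \<le> diff_coeff m \<alpha> x"
    unfolding diff_coeff_def using m0 m_pos[of x] by (intro mult_mono) auto
  have "1 \<le> (4 * r) powr \<alpha>" using r \<alpha> by (intro ge_one_powr_ge_zero) auto
  moreover have "norm x powr \<alpha> \<le> (4 * r) powr \<alpha>" using n r \<alpha> by (intro powr_mono2) auto
  ultimately have "1 + norm x powr \<alpha> \<le> 2 * (4 powr \<alpha> * r powr \<alpha>)"
    using r by (simp add: powr_mult)
  then have "m x * (1 + norm x powr \<alpha>) \<le> M1 * (2 * (4 powr \<alpha> * r powr \<alpha>))"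
    using M1 M1p m_pos[of x] by (intro mult_mono) auto
  then show "diff_coeff m \<alpha> x \<le> 2 * M1 * 4 powr \<alpha> * r powr \<alpha>"
    by (simp add: diff_coeff_def mult_ac)
  show "decay x \<le> r powr (2 - real CARD('n))"
    unfolding decay_def using n r N3 by (intro powr_mono2') auto
qed

text \<open>The test functions are bumps of radius \<open>r\<close> about points at distance \<open>2 * r\<close> from the origin. Being
  of order one on balls of radius comparable to \<open>r\<close>, they satisfy $\|u\|^2 \sim r^{N-\alpha}$ and
  $\|Lu\|^2 \lesssim r^{N+\alpha-4}$, hence $\|u\| \|Lu\| \lesssim r^{N-2}$, and
  $\int \phi |u| \, d\mu \lesssim r^{2-N} r^{N-\alpha}$.\<close>

lemma scaled_test_functions:
  obtains k K D where "0 < k" "0 < K"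
    "\<And>r. 1 \<le> r \<Longrightarrow> \<exists>u f. L_graph m \<alpha> u f \<and>
      k * r powr (real CARD('n) - \<alpha>) \<le> (L2_norm \<mu> u)\<^sup>2 \<and>
      L2_norm \<mu> u * L2_norm \<mu> f \<le> K * r powr (real CARD('n) - 2) \<and>
      \<bar>\<integral>x. decay x * norm (u x) \<partial>\<mu>\<bar> \<le> D * r powr (2 - \<alpha>)"
proof -
  define N where "N = CARD('n)"
  define V where "V = unit_ball_vol (real N)"
  define \<kappa> where "\<kappa> = 6 * (real N + 4)"
  define k where "k = (3 / 4) ^ 6 * V * (1 / 2) ^ N / (2 * M1 * 4 powr \<alpha>)"
  define K where "K = 2 * M1 * 4 powr \<alpha> * \<kappa> * V / m0"
  define D where "D = V / m0"
  have pos: "0 < V" "0 < \<kappa>" "0 < M1" "0 < m0"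
    using m_pos[of 0] M1[of 0] m0 by (auto simp: V_def \<kappa>_def N_def)
  show thesis
  proof (rule that)
    show "0 < k" "0 < K" using pos by (auto simp: k_def K_def)
    fix r :: real assume r: "1 \<le> r"
    have r_pow: "r ^ N = r powr real N" using r by (simp add: powr_realpow)
    obtain c :: "real^'n" where c: "norm c = 2 * r"
      using vector_choose_size[of "2 * r"] r by auto
    define u where "u = (\<lambda>x. complex_of_real (bump 3 c r x))"
    obtain f where f: "L_graph m \<alpha> u f"
      "\<And>x. norm (f x) \<le> diff_coeff m \<alpha> x * (\<kappa> / r\<^sup>2) * indicator (ball c r) x"
      using bump_in_domain[of r c] r unfolding u_def \<kappa>_def N_def by auto
    have uL: "u \<in> L2 \<mu>" and fL: "f \<in> L2 \<mu>"
      using L_graph_L2[OF m_cont m_pos \<alpha>_pos f(1)] by auto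
    note [measurable] = L2_measurable[OF uL, unfolded measurable_\<mu>] L2_measurable[OF fL, unfolded measurable_\<mu>]
    define lo hi where "lo = m0 * r powr \<alpha>" and "hi = 2 * M1 * 4 powr \<alpha> * r powr \<alpha>"
    have lohi: "0 < lo" "0 < hi" using pos r by (auto simp: lo_def hi_def)
    note cb = coeff_bounds_on_ball[OF r c, folded lo_def hi_def]
    have u_le: "norm (u x) \<le> indicator (ball c r) x" for x
      using bump_bounds[of 3 c r x] bump_eq_0_iff[of 3 r c x] r by (auto simp: u_def indicator_def)
    have u_norm_le: "(L2_norm \<mu> u)\<^sup>2 \<le> 1 / lo * (V * r ^ N)"
      unfolding L2_norm_sq V_def N_def
    proof (rule integral_ball_le[where c=c])
      show "(norm (u x))\<^sup>2 \<le> 1 * indicator (ball c r) x" for x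
        using u_le[of x] by (cases "x \<in> ball c r") (auto intro: power_le_one)
    qed (use cb lohi r in auto)
    have f_norm_le: "(L2_norm \<mu> f)\<^sup>2 \<le> (hi * (\<kappa> / r\<^sup>2))\<^sup>2 / lo * (V * r ^ N)"
      unfolding L2_norm_sq V_def N_def
    proof (rule integral_ball_le[where c=c])
      show "(norm (f x))\<^sup>2 \<le> (hi * (\<kappa> / r\<^sup>2))\<^sup>2 * indicator (ball c r) x" for x
      proof (cases "x \<in> ball c r")
        case True
        have "norm (f x) \<le> diff_coeff m \<alpha> x * (\<kappa> / r\<^sup>2)" using f(2)[of x] True by simp
        also have "\<dots> \<le> hi * (\<kappa> / r\<^sup>2)" using cb(2)[OF True] pos by (intro mult_right_mono) auto
        finally have "(norm (f x))\<^sup>2 \<le> (hi * (\<kappa> / r\<^sup>2))\<^sup>2" by (intro power_mono) auto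
        with True show ?thesis by simp
      next
        case False
        then show ?thesis using f(2)[of x] by simp
      qed
    qed (use cb lohi r in auto)
    have "(L2_norm \<mu> u * L2_norm \<mu> f)\<^sup>2 = (L2_norm \<mu> u)\<^sup>2 * (L2_norm \<mu> f)\<^sup>2"
      by (rule power_mult_distrib)
    also have "\<dots> \<le> (1 / lo * (V * r ^ N)) * ((hi * (\<kappa> / r\<^sup>2))\<^sup>2 / lo * (V * r ^ N))"
      using pos lohi r by (intro mult_mono u_norm_le f_norm_le) auto
    also have "\<dots> = (hi / lo * (\<kappa> / r\<^sup>2) * (V * r ^ N))\<^sup>2"
      by (simp add: power2_eq_square mult_ac)
    finally have "L2_norm \<mu> u * L2_norm \<mu> f \<le> hi / lo * (\<kappa> / r\<^sup>2) * (V * r ^ N)"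
      by (rule power2_le_imp_le) (use pos lohi r in auto)
    also have "hi / lo = 2 * M1 * 4 powr \<alpha> / m0" using r by (simp add: hi_def lo_def)
    also have "2 * M1 * 4 powr \<alpha> / m0 * (\<kappa> / r\<^sup>2) * (V * r ^ N) = K * (r powr real N / r powr 2)"
      using r by (simp add: K_def r_pow powr_numeral)
    finally have uf: "L2_norm \<mu> u * L2_norm \<mu> f \<le> K * r powr (real N - 2)" by (simp add: powr_diff)
    have "(3 / 4) ^ 6 / hi * (V * (r / 2) ^ N) \<le> (L2_norm \<mu> u)\<^sup>2"
      unfolding L2_norm_sq V_def N_def
    proof (rule integral_ball_ge[where c=c])
      show "integrable \<mu> (\<lambda>x. (norm (u x))\<^sup>2)" using uL by (simp add: L2_def)
      fix x
      show "(3 / 4) ^ 6 * indicator (ball c (r / 2)) x \<le> (norm (u x))\<^sup>2"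
      proof (cases "x \<in> ball c (r / 2)")
        case True
        have "(norm (x - c))\<^sup>2 \<le> (r / 2)\<^sup>2"
          using True by (intro power_mono) (auto simp: dist_norm norm_minus_commute)
        then have "(norm (x - c))\<^sup>2 / r\<^sup>2 \<le> 1 / 4" using r by (simp add: field_simps)
        then have "3 / 4 \<le> max 0 (1 - (norm (x - c))\<^sup>2 / r\<^sup>2)" by linarith
        then have "(3 / 4) ^ 6 \<le> max 0 (1 - (norm (x - c))\<^sup>2 / r\<^sup>2) ^ 6" by (rule power_mono) simp
        also have "\<dots> = (norm (u x))\<^sup>2" unfolding u_def norm_of_real bump_def power2_abs by (simp flip: power_mult)
        finally show ?thesis using True by simp
      qed simp
    next
      fix x assume "x \<in> ball c (r / 2)"
      then have "x \<in> ball c r" using r by auto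
      then show "diff_coeff m \<alpha> x \<le> hi" by (rule cb(2))
    qed (use lohi r in auto)
    also have "(3 / 4) ^ 6 / hi * (V * (r / 2) ^ N) = k * (r powr real N / r powr \<alpha>)"
      using r pos by (simp add: k_def hi_def r_pow power_divide mult_ac)
    finally have u_ge: "k * r powr (real N - \<alpha>) \<le> (L2_norm \<mu> u)\<^sup>2" by (simp add: powr_diff)
    have "(\<integral>x. decay x * norm (u x) \<partial>\<mu>) \<le> r powr (2 - real N) / lo * (V * r ^ N)"
      unfolding V_def N_def
    proof (rule integral_ball_le[where c=c])
      show "0 \<le> decay x * norm (u x)" for x using decay_pos[of x] by simp
      show "decay x * norm (u x) \<le> r powr (2 - real CARD('n)) * indicator (ball c r) x" for x
      proof (cases "x \<in> ball c r")
        case True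
        then have "decay x * norm (u x) \<le> r powr (2 - real CARD('n)) * 1"
          using cb(3)[OF True] u_le[of x] decay_pos[of x] by (intro mult_mono) auto
        with True show ?thesis by simp
      next
        case False
        then show ?thesis using u_le[of x] by simp
      qed
    qed (use cb lohi r in auto)
    also have "\<dots> = D * (r powr (2 - real N) * r powr real N / r powr \<alpha>)"
      by (simp add: D_def lo_def r_pow)
    also have "\<dots> = D * r powr (2 - \<alpha>)" using r by (simp add: powr_diff powr_add[symmetric])
    finally have "(\<integral>x. decay x * norm (u x) \<partial>\<mu>) \<le> D * r powr (2 - \<alpha>)" .
    moreover have "0 \<le> (\<integral>x. decay x * norm (u x) \<partial>\<mu>)"
      by (intro Bochner_Integration.integral_nonneg mult_nonneg_nonneg less_imp_le[OF decay_pos]) simp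
    ultimately have "\<bar>\<integral>x. decay x * norm (u x) \<partial>\<mu>\<bar> \<le> D * r powr (2 - \<alpha>)" by simp
    then show "\<exists>u f. L_graph m \<alpha> u f \<and>
      k * r powr (real CARD('n) - \<alpha>) \<le> (L2_norm \<mu> u)\<^sup>2 \<and>
      L2_norm \<mu> u * L2_norm \<mu> f \<le> K * r powr (real CARD('n) - 2) \<and>
      \<bar>\<integral>x. decay x * norm (u x) \<partial>\<mu>\<bar> \<le> D * r powr (2 - \<alpha>)"
      using f(1) u_ge uf unfolding N_def by blast
  qed
qed

end

lemma locally_Holder_imp_continuous_on:
  fixes m :: "'a::heine_borel \<Rightarrow> real"
  assumes "locally_Holder m" shows "continuous_on UNIV m"
proof (rule continuous_at_imp_continuous_on, intro ballI)
  fix x :: 'a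
  obtain \<gamma> C where \<gamma>: "0 < \<gamma>" and C: "\<And>y z. \<lbrakk>y \<in> cball x 1; z \<in> cball x 1\<rbrakk> \<Longrightarrow> \<bar>m y - m z\<bar> \<le> C * dist y z powr \<gamma>"
    using assms compact_cball[of x 1] unfolding locally_Holder_def by meson
  have "((\<lambda>y. C * dist y x powr \<gamma>) \<longlongrightarrow> C * dist x x powr \<gamma>) (at x)"
    using \<gamma> by (intro tendsto_intros tendsto_powr') auto
  then have lim: "((\<lambda>y. C * dist y x powr \<gamma>) \<longlongrightarrow> 0) (at x)" by simp
  have "\<forall>\<^sub>F y in at x. y \<in> ball x 1" by (intro eventually_at_in_open') auto
  then have "\<forall>\<^sub>F y in at x. norm (m y - m x) \<le> C * dist y x powr \<gamma>"
    by eventually_elim (use C in auto)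
  then have "((\<lambda>y. m y - m x) \<longlongrightarrow> 0) (at x)" using lim by (rule Lim_null_comparison)
  then show "isCont m x" unfolding isCont_def by (simp add: LIM_zero_iff)
qed

theorem mainTheorem3:
  fixes m :: "real^'n \<Rightarrow> real"
    and \<alpha> \<beta> :: real
    and T :: "real \<Rightarrow> (real^'n \<Rightarrow> complex) \<Rightarrow> real^'n \<Rightarrow> complex"
    and p :: "real^'n \<Rightarrow> real^'n \<Rightarrow> real \<Rightarrow> real"
  assumes "3 \<le> CARD('n)"
    and "bounded (range m)" and "locally_Holder m" and "0 < (INF x. m x)"
    and "semigroup_generated_by_L m \<alpha> T"
    and "kernel_of m \<alpha> T p"
    and "2 < \<alpha>" and "\<alpha> \<le> 4" and "0 < \<beta>"
    and "\<exists>C>0. \<forall>t x y. 0 < t \<and> t \<le> 1 \<longrightarrow>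
           p_mu m \<alpha> p x y t \<le> C / t powr \<beta> * (1 + norm x) powr (2 - real CARD('n))
                                            * (1 + norm y) powr (2 - real CARD('n))"
  shows "\<beta> \<ge> (real CARD('n) + \<alpha> - 4) / (\<alpha> - 2)"
proof -
  have m_cont: "continuous_on UNIV m" by (rule locally_Holder_imp_continuous_on[OF assms(3)])
  define m0 where "m0 = (INF x. m x)"
  have m0: "0 < m0" "m0 \<le> m x" for x
    using assms(4) bounded_imp_bdd_below[OF assms(2)] by (auto simp: m0_def intro: cINF_lower)
  obtain M1 where M1: "\<And>x. m x \<le> M1"
    using bounded_imp_bdd_above[OF assms(2)] by (auto simp: bdd_above_def)
  note ctx = m_cont m0(1) m0(2) M1 assms(7) assms(1)
  obtain C where C: "0 < C" "\<And>t x y. \<lbrakk>0 < t; t \<le> 1\<rbrakk> \<Longrightarrow>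
      p_mu m \<alpha> p x y t \<le> C / t powr \<beta> * decay x * decay y"
    using assms(10) unfolding decay_def by blast
  obtain k K D where k: "0 < k" "0 < K" and test: "\<And>r. 1 \<le> r \<Longrightarrow> \<exists>u f. L_graph m \<alpha> u f \<and>
      k * r powr (real CARD('n) - \<alpha>) \<le> (L2_norm (weighted_measure m \<alpha>) u)\<^sup>2 \<and>
      L2_norm (weighted_measure m \<alpha>) u * L2_norm (weighted_measure m \<alpha>) f \<le> K * r powr (real CARD('n) - 2) \<and>
      \<bar>\<integral>x. decay x * norm (u x) \<partial>weighted_measure m \<alpha>\<bar> \<le> D * r powr (2 - \<alpha>)"
    using scaled_test_functions[OF ctx] by blast
  show ?thesis
  proof (rule scaling_exponent[OF k])
    show "0 \<le> C * D\<^sup>2" using C by simp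
    show "2 < \<alpha>" by (rule assms(7))
    fix r t :: real assume r: "1 \<le> r" and t: "0 < t" "t \<le> 1"
    let ?\<mu> = "weighted_measure m \<alpha>"
    obtain u f where u: "L_graph m \<alpha> u f"
      "k * r powr (real CARD('n) - \<alpha>) \<le> (L2_norm ?\<mu> u)\<^sup>2"
      "L2_norm ?\<mu> u * L2_norm ?\<mu> f \<le> K * r powr (real CARD('n) - 2)"
      "\<bar>\<integral>x. decay x * norm (u x) \<partial>?\<mu>\<bar> \<le> D * r powr (2 - \<alpha>)"
      using test[OF r] by blast
    have "\<bar>\<integral>x. decay x * norm (u x) \<partial>?\<mu>\<bar>\<^sup>2 \<le> (D * r powr (2 - \<alpha>))\<^sup>2"
      using u(4) by (intro power_mono) auto
    also have "\<dots> = D\<^sup>2 * r powr (4 - 2 * \<alpha>)"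
      by (simp add: power_mult_distrib power2_eq_square[of "r powr _"] powr_add[symmetric])
    finally have I: "(\<integral>x. decay x * norm (u x) \<partial>?\<mu>)\<^sup>2 \<le> D\<^sup>2 * r powr (4 - 2 * \<alpha>)" by simp
    have "k * r powr (real CARD('n) - \<alpha>) \<le> (L2_norm ?\<mu> u)\<^sup>2" by (rule u)
    also have "\<dots> \<le> t * (L2_norm ?\<mu> u * L2_norm ?\<mu> f) + C / t powr \<beta> * (\<integral>x. decay x * norm (u x) \<partial>?\<mu>)\<^sup>2"
      by (rule weighted_Nash_inequality[OF ctx assms(5,6,9) C u(1) t])
    also have "\<dots> \<le> t * (K * r powr (real CARD('n) - 2)) + C / t powr \<beta> * (D\<^sup>2 * r powr (4 - 2 * \<alpha>))"
      using t C u(3) I by (intro add_mono mult_left_mono) auto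
    finally show "k * r powr (real CARD('n) - \<alpha>)
        \<le> t * (K * r powr (real CARD('n) - 2)) + C * D\<^sup>2 / t powr \<beta> * r powr (4 - 2 * \<alpha>)"
      by simp
  qed
qed

end
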